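(* Let $n\in\mathbb N$, let $A$ be a Young function with $A(t)\sim t^n(\log t)^q$ near infinity for some $q>n-1$, and let $\varphi$ be a gauge function with $\varphi(r)\sim(\log\frac1r)^\beta$ near zero for some $\beta<0$. Set $\sigma=\frac{n\beta}{n-q-1+\beta}$, let $\mu>1+\sigma$, and let $\phi$ be a gauge function with $\phi(r)\sim r^\sigma(\log\frac1r)^\mu$ near zero. Then there exist a map $u\in V^{1,A}(\mathbb R^n,\mathbb R^n)$ and a compact set $E\subset\mathbb R^n$ such that $0<\mathscr H^\varphi(E)<\infty$ and $\mathscr H^\phi(u(E))=\infty$.
   Context: A gauge function is an increasing continuous function $\phi\colon[0,\infty)\to[0,\infty)$ vanishing only at $0$. For $E\subset\mathbb R^k$, $\mathscr H^\phi(E)=\lim_{\sigma\to0^+}\inf\{\sum_i\phi(d(E_i)): d(E_i)\le\sigma, E\subset\bigcup_iE_i\}$ ($d$ = diameter). A Young function is a non-trivial convex $A\colon[0,\infty)\to[0,\infty]$ with $A(0)=0$; $L^A$ is the Orlicz space with Luxemburg norm $\|f\|_{L^A}=\inf\{\lambda>0:\int A(|f|/\lambda)\le1\}$, and $V^{1,A}(\mathbb R^n,\mathbb R^n)$ is the space of weakly differentiable $u\in L^1_{\rm loc}$ with $|\nabla u|\in L^A(\mathbb R^n)$ (continuous representative used). "$f\sim g$ near zero (near infinity)" means $c^{-1}g\le f\le cg$ on some interval $(0,r_0)$ (on some $(t_0,\infty)$) for a constant $c>0$. *)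

theory Defs
  imports "HOL-Analysis.Analysis"
begin

definition gauge_function :: "(real \<Rightarrow> real) \<Rightarrow> bool" where
  "gauge_function \<phi> \<longleftrightarrow> mono_on {0..} \<phi> \<and> continuous_on {0..} \<phi> \<and> \<phi> 0 = 0
      \<and> (\<forall>t>0. \<phi> t > 0)"

definition hausdorff_pre :: "(real \<Rightarrow> real) \<Rightarrow> real \<Rightarrow> 'a::euclidean_space set \<Rightarrow> ennreal" where
  "hausdorff_pre \<phi> \<delta> E =
     (INF C \<in> {C :: nat \<Rightarrow> 'a set. E \<subseteq> (\<Union>i. C i) \<and>
                 (\<forall>i. bounded (C i) \<and> diameter (C i) \<le> \<delta>)}.
        \<Sum>i. ennreal (\<phi> (diameter (C i))))"

text \<open>Gauge Hausdorff measure: the limit as delta tends to 0+, which (by monotonicity in delta)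
  is the supremum over delta > 0.\<close>
definition hausdorff_gauge :: "(real \<Rightarrow> real) \<Rightarrow> 'a::euclidean_space set \<Rightarrow> ennreal" where
  "hausdorff_gauge \<phi> E = (SUP \<delta> \<in> {0<..}. hausdorff_pre \<phi> \<delta> E)"

definition young_function :: "(real \<Rightarrow> real) \<Rightarrow> bool" where
  "young_function A \<longleftrightarrow> convex_on {0..} A \<and> A 0 = 0 \<and> (\<forall>t\<ge>0. A t \<ge> 0) \<and> (\<exists>t>0. A t > 0)"

definition equiv_at_infinity :: "(real \<Rightarrow> real) \<Rightarrow> (real \<Rightarrow> real) \<Rightarrow> bool" where
  "equiv_at_infinity f g \<longleftrightarrow> (\<exists>c>0. \<exists>t0. \<forall>t>t0. g t / c \<le> f t \<and> f t \<le> c * g t)"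

definition equiv_near_zero :: "(real \<Rightarrow> real) \<Rightarrow> (real \<Rightarrow> real) \<Rightarrow> bool" where
  "equiv_near_zero f g \<longleftrightarrow> (\<exists>c>0. \<exists>r0>0. \<forall>r\<in>{0<..<r0}. g r / c \<le> f r \<and> f r \<le> c * g r)"

definition locally_integrable :: "('a::euclidean_space \<Rightarrow> 'b::{banach,second_countable_topology}) \<Rightarrow> bool" where
  "locally_integrable f \<longleftrightarrow> (\<forall>K. compact K \<longrightarrow> set_integrable lebesgue K f)"

definition partial_deriv :: "'n::finite \<Rightarrow> (real^'n \<Rightarrow> real) \<Rightarrow> real^'n \<Rightarrow> real" where
  "partial_deriv j f x = frechet_derivative f (at x) (axis j 1)"

fun Ck :: "nat \<Rightarrow> (real^'n::finite \<Rightarrow> real) \<Rightarrow> bool" where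
  "Ck 0 f = continuous_on UNIV f"
| "Ck (Suc k) f = (continuous_on UNIV f \<and> (\<forall>x. f differentiable (at x)) \<and>
                   (\<forall>j. Ck k (partial_deriv j f)))"

definition test_function :: "(real^'n::finite \<Rightarrow> real) \<Rightarrow> bool" where
  "test_function \<psi> \<longleftrightarrow> (\<forall>k. Ck k \<psi>) \<and> compact (closure {x. \<psi> x \<noteq> 0})"

definition weak_gradient :: "(real^'n::finite \<Rightarrow> real^'n) \<Rightarrow> (real^'n \<Rightarrow> real^'n^'n) \<Rightarrow> bool" where
  "weak_gradient u G \<longleftrightarrow> locally_integrable u \<and> locally_integrable G \<and>
     (\<forall>\<psi>. test_function \<psi> \<longrightarrow> (\<forall>i j.
        (\<integral>x. u x $ i * partial_deriv j \<psi> x \<partial>lebesgue) = - (\<integral>x. G x $ i $ j * \<psi> x \<partial>lebesgue)))"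

text \<open>Membership in the Orlicz space L^A (Luxemburg norm finite).\<close>
definition in_orlicz :: "(real \<Rightarrow> real) \<Rightarrow> ('a::euclidean_space \<Rightarrow> real) \<Rightarrow> bool" where
  "in_orlicz A f \<longleftrightarrow> f \<in> borel_measurable lebesgue \<and>
     (\<exists>l>0. (\<integral>\<^sup>+ x. ennreal (A (\<bar>f x\<bar> / l)) \<partial>lebesgue) \<le> 1)"

text \<open>V^{1,A}(R^n,R^n): weakly differentiable, with |\<nabla>u| (Frobenius norm) in L^A.\<close>
definition V1A :: "(real \<Rightarrow> real) \<Rightarrow> (real^'n::finite \<Rightarrow> real^'n) set" where
  "V1A A = {u. \<exists>G. weak_gradient u G \<and> in_orlicz A (\<lambda>x. norm (G x))}"

end

theory Submission
  imports Defs "HOL-Probability.Probability"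
begin

text \<open>
  Both sets are coded by sequences \<open>e\<close> of vectors in \<open>{0,1}^n\<close>: \<open>E\<close> consists of the points
  \<open>\<Sum>k. r k * e k\<close> and \<open>u(E)\<close> of the points \<open>\<Sum>k. h k * e k\<close>. With \<open>m = 2 ^ n\<close> choose
  \<open>ln (1 / r k) = L * \<tau> ^ k\<close> where \<open>\<tau> powr (- \<beta>) = m\<close>, so that \<open>m ^ k * \<phi> (r k)\<close> stays
  bounded above and below, and \<open>h k = a k * m powr (- k / \<sigma>)\<close> with the summable weights
  \<open>a k \<sim> k powr (- 1 - 1 / \<sigma>)\<close>, so that \<open>m ^ k * \<Phi> (h k)\<close> is at least of the order
  \<open>k powr (\<mu> - \<sigma> - 1)\<close>. The uniform product measure on codes then yields the lower bounds of both
  Hausdorff measures.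

  The map \<open>u\<close> is a sum over all levels and all cylinders of a displacement times a cutoff that is a
  function of \<open>ln |x - c| / ln (r k)\<close>. Since \<open>ln (r k)\<close> grows geometrically, such a cutoff fits
  between two consecutive scales, and its gradient is of size \<open>1 / (|x - c| * L * \<tau> ^ k)\<close>. A
  displacement of size \<open>H\<close> costs the energy \<open>H ^ n * (L * \<tau> ^ k) powr (q + 1 - n)\<close> per cylinder. By
  the choice of \<open>\<sigma>\<close>, the displacements \<open>m powr (- k / \<sigma>)\<close> have the same total energy at every
  level, and convexity of \<open>A\<close> allows one to sum the levels with the weights \<open>a k\<close>.
\<close>

section \<open>Hausdorff measures of coded sets\<close>

text \<open>Up to logarithms the \<open>n\<close>-energy is scale invariant. In the energy of one
  cylinder the slope of the cutoff contributes the exponent \<open>- n\<close> of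
  \<open>L * \<tau> ^ k\<close>, the logarithm in \<open>A\<close> contributes \<open>q\<close>, and
  the number of dyadic scales crossed contributes 1. Equal energy at all levels is therefore the
  equation \<open>m * h0 ^ n * \<tau> powr (q + 1 - n) = 1\<close> for the ratio \<open>h0\<close>
  of the displacements; with \<open>\<tau> = m powr (- 1 / \<beta>)\<close> and
  \<open>h0 = m powr (- 1 / \<sigma>)\<close> its solution is the \<sigma> of the statement. Levels
  of equal energy cannot simply be added up, which is the reason for the weights. With
  \<open>a k\<close> of order \<open>k powr (- p)\<close>, summability asks for
  \<open>p > 1\<close>, and divergence of \<open>m ^ k * \<Phi> (h k)\<close>, of order
  \<open>k powr (\<mu> - p * \<sigma>)\<close>, asks for \<open>p * \<sigma> < \<mu>\<close>; the
  choice \<open>p = 1 + 1 / \<sigma>\<close> turns the latter into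
  \<open>\<mu> > 1 + \<sigma>\<close>.\<close>

lemma gauge_function_mono:
  assumes "gauge_function \<psi>" "0 \<le> s" "s \<le> t"
  shows "\<psi> s \<le> \<psi> t"
  using assms mono_onD[of "{0..}" \<psi> s t] by (auto simp: gauge_function_def)

text \<open>Mass distribution principle, carried out on the code space: each covering set is
  replaced by a cylinder that contains its preimage under \<open>z\<close>, and the cylinders, of
  total mass at least 1, are charged against the gauge values. This avoids every measurability
  question about \<open>z\<close> and the covering sets.\<close>

lemma hausdorff_gauge_ge_coded:
  fixes z :: "(nat \<Rightarrow> 'b::finite) \<Rightarrow> 'a::euclidean_space"
  assumes \<psi>: "gauge_function \<psi>"
    and pos: "\<And>k. s k > 0" and lim: "s \<longlonglongrightarrow> 0"
    and sep: "\<And>e e' k. dist (z e) (z e') < s k \<Longrightarrow> \<forall>j\<le>k. e j = e' j"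
    and card: "CARD('b) \<ge> 2"
    and K: "K > 0" "\<And>k. k \<ge> k0 \<Longrightarrow> K \<le> \<psi> (s k) * real CARD('b) ^ k"
  shows "hausdorff_gauge \<psi> (range z) \<ge> ennreal K"
proof -
  define m where "m = real CARD('b)"
  have m2: "m \<ge> 2" using card by (simp add: m_def)
  define U where "U = uniform_count_measure (UNIV :: 'b set)"
  interpret U: prob_space U unfolding U_def by (rule prob_space_uniform_count_measure) auto
  interpret P: product_prob_space "\<lambda>_::nat. U" UNIV ..
  define Q where "Q = PiM (UNIV::nat set) (\<lambda>_. U)"
  have spQ: "space Q = UNIV" by (auto simp: Q_def space_PiM U_def space_uniform_count_measure)
  define cyl where "cyl = (\<lambda>(p::nat \<Rightarrow> 'b) k. {e. \<forall>j\<in>{..<k}. e j \<in> {p j}})"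
  have em: "emeasure Q (cyl p k) = ennreal ((1/m)^k)" and cs: "cyl p k \<in> sets Q" for p k
  proof -
    have s: "{p j} \<in> sets U" for j by (simp add: U_def)
    have 1: "emeasure U {p j} = ennreal (1/m)" for j
      by (simp add: U_def emeasure_uniform_count_measure m_def)
    have "{x \<in> space Q. \<forall>j\<in>{..<k}. x j \<in> {p j}} \<in> sets Q"
      unfolding Q_def by measurable (simp add: U_def sets_uniform_count_measure)
    then show "cyl p k \<in> sets Q" by (simp add: cyl_def spQ)
    show "emeasure Q (cyl p k) = ennreal ((1/m)^k)"
    proof (cases "k = 0")
      case True
      then show ?thesis using P.emeasure_space_1 spQ by (simp add: cyl_def Q_def)
    next
      case False
      then have "emeasure Q {x \<in> space Q. \<forall>j\<in>{..<k}. x j \<in> {p j}} = (\<Prod>j\<in>{..<k}. emeasure U {p j})"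
        unfolding Q_def by (intro P.emeasure_PiM_Collect) (auto simp: s)
      also have "\<dots> = ennreal ((1/m)^k)" using m2 by (simp add: 1 ennreal_power)
      finally show ?thesis by (simp add: cyl_def spQ)
    qed
  qed
  \<comment> \<open>The factor 1/2 keeps all diameters strictly below \<open>s k0\<close>, so the
    level found below has a predecessor that is still at least \<open>k0\<close>.\<close>
  have "hausdorff_pre \<psi> (s k0 / 2) (range z) \<ge> ennreal K"
    unfolding hausdorff_pre_def
  proof (rule INF_greatest, safe)
    fix C :: "nat \<Rightarrow> 'a set"
    assume cov: "range z \<subseteq> (\<Union>i. C i)" and C: "\<forall>i. bounded (C i) \<and> diameter (C i) \<le> s k0 / 2"
    define d where "d i = diameter (C i)" for i
    have close: "\<forall>j\<le>k. e j = e' j" if "z e \<in> C i" "z e' \<in> C i" "d i < s k" for e e' i k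
      using sep[of e e' k] diameter_bounded_bound[of "C i" "z e" "z e'"] C that by (force simp: d_def)
    \<comment> \<open>A covering set of diameter zero has gauge value 0, but every cylinder has
      positive mass. The summable error \<open>\<epsilon> * (1/2)^i\<close> pays for such a set, by
      way of a sufficiently long cylinder.\<close>
    have *: "\<exists>k p. z -` C i \<subseteq> cyl p k \<and> (1/m)^k \<le> \<psi> (d i) / K + \<epsilon> * (1/2)^i" if "\<epsilon> > 0" for i and \<epsilon> :: real
    proof (cases "d i = 0")
      case True
      obtain k where k: "(1/m)^k < \<epsilon> * (1/2)^i"
        using real_arch_pow_inv[of "\<epsilon> * (1/2)^i" "1/m"] \<open>\<epsilon> > 0\<close> m2 by auto
      have "\<exists>p. z -` C i \<subseteq> cyl p k"
      proof (cases "z -` C i = {}")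
        case False
        then obtain p where p: "z p \<in> C i" by auto
        have "e j = p j" if "z e \<in> C i" for e j
          using close[OF that p, of j] True pos[of j] by auto
        then have "z -` C i \<subseteq> cyl p k" by (auto simp: cyl_def)
        then show ?thesis by blast
      qed auto
      moreover have "\<psi> (d i) = 0" using \<psi> True by (simp add: gauge_function_def)
      ultimately show ?thesis using less_imp_le[OF k] by auto
    next
      case False
      then have dpos: "d i > 0" using diameter_ge_0[of "C i"] C by (simp add: d_def less_le)
      \<comment> \<open>At the predecessor \<open>k\<close> of this level \<open>d i < s k\<close>
        still holds, so \<open>sep\<close> forces agreement up to \<open>k\<close> inclusive: a
        cylinder of length exactly \<open>j\<close>, the level at which \<open>s j \<le> d i\<close>
        compares its mass with \<open>\<psi> (d i)\<close>.\<close>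
      define j where "j = (LEAST j. j \<ge> k0 \<and> s j \<le> d i)"
      have ex: "\<exists>j. j \<ge> k0 \<and> s j \<le> d i"
      proof -
        obtain N where "\<forall>k\<ge>N. s k < d i"
          using order_tendstoD(2)[OF lim dpos] unfolding eventually_sequentially by blast
        then show ?thesis by (intro exI[of _ "max k0 N"]) (simp add: less_imp_le)
      qed
      have j: "j \<ge> k0" "s j \<le> d i" using LeastI_ex[OF ex] by (auto simp: j_def)
      have "j \<noteq> k0" using j C pos[of k0] by (auto simp: d_def dest: spec[of _ i])
      then obtain k where jk: "j = Suc k" "k \<ge> k0" using j by (cases j) auto
      have "d i < s k" using not_less_Least[of k "\<lambda>j. j \<ge> k0 \<and> s j \<le> d i"] jk by (auto simp: j_def)
      have "\<exists>p. z -` C i \<subseteq> cyl p j"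
      proof (cases "z -` C i = {}")
        case False
        then obtain p where p: "z p \<in> C i" by auto
        have "z -` C i \<subseteq> cyl p j" using close[OF _ p \<open>d i < s k\<close>] jk by (auto simp: cyl_def)
        then show ?thesis by blast
      qed auto
      moreover have "(1/m)^j \<le> \<psi> (d i) / K"
      proof -
        have "K \<le> \<psi> (s j) * m ^ j" using K(2)[OF j(1)] by (simp add: m_def)
        also have "\<psi> (s j) \<le> \<psi> (d i)"
          using j pos[of j] by (intro gauge_function_mono[OF \<psi>]) auto
        finally have "K \<le> \<psi> (d i) * m ^ j" using m2 by (simp add: mult_right_mono)
        then show ?thesis using K(1) m2 by (simp add: field_simps power_divide)
      qed
      moreover have "\<epsilon> * (1/2)^i \<ge> 0" using that by simp
      ultimately show ?thesis by (intro exI[of _ j]) auto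
    qed
    have \<psi>0: "\<psi> (d i) \<ge> 0" for i
      using \<psi> diameter_ge_0[of "C i"] C by (cases "d i = 0") (auto simp: gauge_function_def d_def less_le)
    have bound: "1 \<le> (\<Sum>i. ennreal (\<psi> (d i))) / ennreal K + ennreal (2 * \<epsilon>)" if "\<epsilon> > 0" for \<epsilon> :: real
    proof -
      have "\<forall>i. \<exists>k p. z -` C i \<subseteq> cyl p k \<and> (1/m)^k \<le> \<psi> (d i) / K + \<epsilon> * (1/2)^i"
        using *[OF \<open>\<epsilon> > 0\<close>] by (intro allI)
      then obtain k p where kp: "\<And>i. z -` C i \<subseteq> cyl (p i) (k i)" "\<And>i. (1/m)^(k i) \<le> \<psi> (d i) / K + \<epsilon> * (1/2)^i"
        by metis
      have "e \<in> (\<Union>i. cyl (p i) (k i))" for e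
      proof -
        obtain i where "z e \<in> C i" using cov by blast
        then have "e \<in> cyl (p i) (k i)" using kp(1)[of i] by auto
        then show ?thesis by blast
      qed
      then have "UNIV = (\<Union>i. cyl (p i) (k i))" by auto
      then have "1 = emeasure Q (\<Union>i. cyl (p i) (k i))" using P.emeasure_space_1 spQ by (simp add: Q_def)
      also have "\<dots> \<le> (\<Sum>i. emeasure Q (cyl (p i) (k i)))"
        using cs by (intro emeasure_subadditive_countably) auto
      also have "\<dots> \<le> (\<Sum>i. ennreal (\<psi> (d i)) / ennreal K + ennreal (\<epsilon> * (1/2)^i))"
      proof (intro suminf_le allI)
        fix i
        have "emeasure Q (cyl (p i) (k i)) \<le> ennreal (\<psi> (d i) / K + \<epsilon> * (1/2)^i)"
          unfolding em by (rule ennreal_leI) (rule kp)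
        also have "\<dots> = ennreal (\<psi> (d i)) / ennreal K + ennreal (\<epsilon> * (1/2)^i)"
          using \<psi>0[of i] K(1) that by (simp add: divide_ennreal)
        finally show "emeasure Q (cyl (p i) (k i)) \<le> \<dots>" .
      qed auto
      also have "\<dots> = (\<Sum>i. ennreal (\<psi> (d i)) / ennreal K) + (\<Sum>i. ennreal (\<epsilon> * (1/2)^i))"
        by (intro suminf_add[symmetric]) auto
      also have "(\<Sum>i. ennreal (\<epsilon> * (1/2)^i)) = ennreal (2 * \<epsilon>)"
      proof (rule suminf_ennreal_eq)
        show "(\<lambda>i. \<epsilon> * (1/2)^i) sums (2 * \<epsilon>)"
          using sums_mult[OF geometric_sums[of "1/2::real"], of \<epsilon>] by (simp add: mult.commute)
      qed (use that in auto)
      also have "(\<Sum>i. ennreal (\<psi> (d i)) / ennreal K) = (\<Sum>i. ennreal (\<psi> (d i))) / ennreal K"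
        by (simp add: divide_ennreal_def)
      finally show ?thesis .
    qed
    have "1 \<le> (\<Sum>i. ennreal (\<psi> (d i))) / ennreal K"
    proof (rule ennreal_le_epsilon)
      fix e :: real assume "0 < e"
      then show "1 \<le> (\<Sum>i. ennreal (\<psi> (d i))) / ennreal K + ennreal e" using bound[of "e/2"] by simp
    qed
    then have "ennreal K \<le> (\<Sum>i. ennreal (\<psi> (d i)))"
      using K(1) divide_less_ennreal[of "ennreal K" "\<Sum>i. ennreal (\<psi> (d i))" 1]
      by (metis ennreal_eq_0_iff ennreal_less_top mult_1 not_le)
    then show "ennreal K \<le> (\<Sum>i. ennreal (\<psi> (diameter (C i))))" by (simp only: d_def)
  qed
  moreover have "s k0 / 2 > 0" using pos[of k0] by simp
  ultimately show ?thesis unfolding hausdorff_gauge_def by (meson SUP_upper2 greaterThan_iff)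
qed

text \<open>The cells of a single level \<open>k\<close>, one for each of the
  \<open>CARD('b) ^ k\<close> words of length \<open>k\<close>, are an efficient enough
  cover.\<close>

lemma hausdorff_gauge_le_coded:
  fixes z :: "(nat \<Rightarrow> 'b::finite) \<Rightarrow> 'a::euclidean_space"
  assumes \<psi>: "gauge_function \<psi>" and t: "\<And>k. t k \<ge> 0" "t \<longlonglongrightarrow> 0"
    and close: "\<And>e e' k. (\<And>j. j < k \<Longrightarrow> e j = e' j) \<Longrightarrow> dist (z e) (z e') \<le> t k"
    and K: "\<And>k. k \<ge> k0 \<Longrightarrow> \<psi> (t k) * real CARD('b) ^ k \<le> K"
  shows "hausdorff_gauge \<psi> (range z) \<le> ennreal K"
  unfolding hausdorff_gauge_def
proof (rule SUP_least)
  fix \<delta> :: real assume "\<delta> \<in> {0<..}"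
  then have "\<forall>\<^sub>F k in sequentially. t k < \<delta>" using order_tendstoD(2)[OF t(2)] by auto
  then obtain N where "\<forall>k\<ge>N. t k < \<delta>" unfolding eventually_sequentially by blast
  then have k: "max k0 N \<ge> k0" "t (max k0 N) < \<delta>" by auto
  define k where "k = max k0 N"
  note k = k[folded k_def]
  define P where "P = PiE {..<k} (\<lambda>_. UNIV :: 'b set)"
  have finP: "finite P" and cardP: "card P = CARD('b) ^ k"
    by (auto simp: P_def card_PiE intro!: finite_PiE)
  define cell where "cell p = z ` {e. \<forall>j<k. e j = p j}" for p
  \<comment> \<open>Covers are sequences, so the finite list of cells is padded with empty sets,
    whose diameter and hence gauge value is 0.\<close>
  define C where "C i h = (if i < card P then cell (h i) else {})" for i and h :: "nat \<Rightarrow> nat \<Rightarrow> 'b"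
  obtain h where h: "bij_betw h {0..<card P} P" using ex_bij_betw_nat_finite[OF finP] by auto
  have cd: "bounded (cell p)" "diameter (cell p) \<le> t k" for p
  proof -
    have d: "dist x y \<le> t k" if "x \<in> cell p" "y \<in> cell p" for x y
      using that by (auto simp: cell_def intro!: close)
    show "diameter (cell p) \<le> t k" using t(1) d by (intro diameter_le) (auto simp: dist_norm)
    show "bounded (cell p)"
    proof (cases "cell p = {}")
      case False
      then obtain x where "x \<in> cell p" by auto
      then show ?thesis using d unfolding bounded_def by blast
    qed auto
  qed
  have "hausdorff_pre \<psi> \<delta> (range z) \<le> (\<Sum>i. ennreal (\<psi> (diameter (C i h))))"
    unfolding hausdorff_pre_def
  proof (rule INF_lower, safe)
    fix e :: "nat \<Rightarrow> 'b"
    have "restrict e {..<k} \<in> P" by (auto simp: P_def)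
    then have "restrict e {..<k} \<in> h ` {0..<card P}" using h by (simp add: bij_betw_def)
    then obtain i where "i < card P" "h i = restrict e {..<k}" by auto
    then have "z e \<in> C i h" by (auto simp: C_def cell_def)
    then show "z e \<in> (\<Union>i. C i h)" by blast
  next
    fix i
    show "bounded (C i h)" "diameter (C i h) \<le> \<delta>"
      using cd[of "h i"] k \<open>\<delta> \<in> _\<close> by (auto simp: C_def)
  qed
  also have "\<dots> = (\<Sum>i<card P. ennreal (\<psi> (diameter (C i h))))"
    using \<psi> by (intro suminf_finite) (auto simp: C_def gauge_function_def)
  also have "\<dots> \<le> (\<Sum>i<card P. ennreal (\<psi> (t k)))"
  proof (intro sum_mono ennreal_leI)
    fix i assume "i \<in> {..<card P}"
    then have "C i h = cell (h i)" by (simp add: C_def)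
    then show "\<psi> (diameter (C i h)) \<le> \<psi> (t k)"
      using cd[of "h i"] diameter_ge_0[of "cell (h i)"]
      by (intro gauge_function_mono[OF \<psi>]) auto
  qed
  also have "\<dots> = ennreal (\<psi> (t k) * real CARD('b) ^ k)"
  proof -
    have "\<psi> (t k) \<ge> 0" using \<psi> t(1)[of k] by (cases "t k = 0") (auto simp: gauge_function_def less_le)
    then show ?thesis by (simp add: cardP ennreal_mult mult.commute ennreal_of_nat_eq_real_of_nat)
  qed
  also have "\<dots> \<le> ennreal K" using K[OF k(1)] by (rule ennreal_leI)
  finally show "hausdorff_pre \<psi> \<delta> (range z) \<le> ennreal K" .
qed

section \<open>Digit expansions with rapidly decaying weights\<close>

definition digit :: "bool^'n::finite \<Rightarrow> real^'n" where
  "digit b = (\<chi> i. of_bool (b $ i))"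

lemma digit_nth [simp]: "digit b $ i = of_bool (b $ i)"
  by (simp add: digit_def)

lemma norm_digit_diff_le: "norm (digit b - digit c :: real^'n::finite) \<le> real CARD('n)"
proof -
  have "norm (digit b - digit c) \<le> (\<Sum>i\<in>UNIV. \<bar>(digit b - digit c) $ i\<bar>)" by (rule norm_le_l1_cart)
  also have "\<dots> \<le> (\<Sum>i\<in>(UNIV::'n set). 1)" by (intro sum_mono) auto
  finally show ?thesis by simp
qed

lemma digit_False [simp]: "digit (\<chi> i. False) = (0 :: real^'n::finite)"
  by (simp add: vec_eq_iff)

lemma norm_digit_le: "norm (digit b :: real^'n::finite) \<le> real CARD('n)"
  using norm_digit_diff_le[of b "\<chi> i. False"] by simp

lemma card_bool_vec: "CARD(bool^'n::finite) = 2 ^ CARD('n)"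
  by simp

definition code_point :: "(nat \<Rightarrow> real) \<Rightarrow> (nat \<Rightarrow> bool^'n::finite) \<Rightarrow> real^'n" where
  "code_point s e = (\<Sum>k. s k *\<^sub>R digit (e k))"

text \<open>Instantiated twice: for \<open>E\<close> with ratio 1/4 and for \<open>u(E)\<close> with
  ratio \<open>h0\<close>. The bound \<open>x < 1/2\<close> gives \<open>x / (1 - x) < 1\<close>, so
  that each weight exceeds the sum of all later ones and codes can be read off from points.\<close>

locale decaying_weights =
  fixes s :: "nat \<Rightarrow> real" and x :: real
  assumes s_pos: "s k > 0" and s_Suc: "s (Suc k) \<le> x * s k" and x: "0 < x" "x < 1/2"
begin

lemma s_add: "s (i + k) \<le> x ^ i * s k"
proof (induction i)
  case (Suc i)
  have "s (Suc i + k) \<le> x * s (i + k)" using s_Suc[of "i + k"] by simp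
  also have "\<dots> \<le> x * (x ^ i * s k)" using Suc x by (intro mult_left_mono) auto
  finally show ?case by (simp add: mult_ac)
qed simp

lemma s_antimono: "j \<le> k \<Longrightarrow> s k \<le> s j"
proof -
  assume "j \<le> k"
  then have "s k \<le> x ^ (k - j) * s j" using s_add[of "k - j" j] by simp
  also have "\<dots> \<le> 1 * s j" using x s_pos[of j] by (intro mult_right_mono power_le_one) auto
  finally show ?thesis by simp
qed

lemma geometric_tail: "(\<lambda>i. x ^ i * s k) sums (s k / (1 - x))"
proof -
  have "norm x < 1" using x by simp
  from sums_mult2[OF geometric_sums[OF this], of "s k"] show ?thesis
    by (simp only: times_divide_eq_left mult_1)
qed

lemma summable_tail: "summable (\<lambda>i. s (i + k))"
proof (rule summable_comparison_test'[OF sums_summable[OF geometric_tail[of k]], of 0])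
  show "norm (s (i + k)) \<le> x ^ i * s k" for i
    using s_add[of i k] s_pos[of "i + k"] by simp
qed

lemma summable_s: "summable s"
  using summable_tail[of 0] by simp

lemma s_tendsto_0: "s \<longlonglongrightarrow> 0"
  by (rule summable_LIMSEQ_zero[OF summable_s])

lemma suminf_tail_le: "(\<Sum>i. s (i + k)) \<le> s k / (1 - x)"
proof -
  have "(\<Sum>i. s (i + k)) \<le> (\<Sum>i. x ^ i * s k)"
    by (rule suminf_le[OF _ summable_tail sums_summable[OF geometric_tail]]) (rule s_add)
  then show ?thesis by (simp only: sums_unique[OF geometric_tail])
qed

lemma summable_code: "summable (\<lambda>k. s k *\<^sub>R digit (e k :: bool^'n::finite))"
proof (rule summable_comparison_test'[where N=0])
  show "summable (\<lambda>k. s k * real CARD('n))" using summable_s by (intro summable_mult2)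
  show "norm (s k *\<^sub>R digit (e k)) \<le> s k * real CARD('n)" for k
    using s_pos[of k] norm_digit_le[of "e k"] by simp
qed

lemma code_point_diff_eq:
  fixes e e' :: "nat \<Rightarrow> bool^'n::finite"
  assumes "\<And>j. j < k \<Longrightarrow> e j = e' j"
  shows "(\<lambda>i. s (i + k) *\<^sub>R (digit (e (i + k)) - digit (e' (i + k)))) sums (code_point s e - code_point s e')"
proof -
  have "(\<lambda>i. s i *\<^sub>R (digit (e i) - digit (e' i))) sums (code_point s e - code_point s e')"
    unfolding code_point_def using sums_diff[OF summable_sums[OF summable_code] summable_sums[OF summable_code], of e e']
    by (simp add: scaleR_diff_right)
  from sums_split_initial_segment[OF this, of k] show ?thesis using assms by simp
qed

lemma dist_code_point_le:
  fixes e e' :: "nat \<Rightarrow> bool^'n::finite"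
  assumes "\<And>j. j < k \<Longrightarrow> e j = e' j"
  shows "dist (code_point s e) (code_point s e') \<le> 2 * real CARD('n) * s k"
proof -
  have eq: "code_point s e - code_point s e' = (\<Sum>i. s (i + k) *\<^sub>R (digit (e (i + k)) - digit (e' (i + k))))"
    by (rule sums_unique[OF code_point_diff_eq[OF assms]])
  have "norm (code_point s e - code_point s e') \<le> (\<Sum>i. s (i + k) * real CARD('n))"
    unfolding eq
  proof (rule norm_suminf_le)
    show "norm (s (i + k) *\<^sub>R (digit (e (i + k)) - digit (e' (i + k)))) \<le> s (i + k) * real CARD('n)" for i
      using s_pos[of "i + k"] norm_digit_diff_le[of "e (i + k)" "e' (i + k)"] by simp
    show "summable (\<lambda>i. s (i + k) * real CARD('n))" using summable_tail by (intro summable_mult2)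
  qed
  also have "\<dots> = (\<Sum>i. s (i + k)) * real CARD('n)" by (rule suminf_mult2[symmetric, OF summable_tail])
  also have "\<dots> \<le> (2 * s k) * real CARD('n)"
  proof (rule mult_right_mono)
    have "s k * 1 \<le> s k * (2 * (1 - x))" using x s_pos[of k] by (intro mult_left_mono) auto
    moreover have "0 < 1 - x" using x by simp
    ultimately have "s k / (1 - x) \<le> 2 * s k" by (simp add: pos_divide_le_eq mult_ac)
    then show "(\<Sum>i. s (i + k)) \<le> 2 * s k" using suminf_tail_le[of k] by linarith
  qed simp
  finally show ?thesis by (simp add: dist_norm mult_ac)
qed

text \<open>Equal to \<open>1 - x / (1 - x)\<close>: the fraction of a weight that survives after
  subtracting the largest possible tail of later weights.\<close>

definition gap :: real where "gap = (1 - 2 * x) / (1 - x)"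

lemma gap_pos: "gap > 0"
  unfolding gap_def using x by (intro divide_pos_pos) linarith+

text \<open>The first level \<open>l\<close> at which the codes differ dominates: in a coordinate
  \<open>c\<close> where the two digits differ, this level contributes exactly \<open>s l\<close> in
  absolute value and all later levels together at most \<open>x * s l / (1 - x)\<close>.\<close>

lemma dist_code_point_ge:
  fixes e e' :: "nat \<Rightarrow> bool^'n::finite"
  assumes "j \<le> k" "e j \<noteq> e' j"
  shows "dist (code_point s e) (code_point s e') \<ge> gap * s k"
proof -
  define l where "l = (LEAST l. e l \<noteq> e' l)"
  have l: "e l \<noteq> e' l" using LeastI[of "\<lambda>l. e l \<noteq> e' l", OF assms(2)] by (simp add: l_def)
  have "l \<le> j" using Least_le[of "\<lambda>l. e l \<noteq> e' l", OF assms(2)] by (simp add: l_def)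
  have agree: "e i = e' i" if "i < l" for i
    using not_less_Least[of i "\<lambda>l. e l \<noteq> e' l"] that unfolding l_def by blast
  obtain c where c: "e l $ c \<noteq> e' l $ c" using l vec_eq_iff[of "e l" "e' l"] by blast
  define D where "D i = (digit (e i) - digit (e' i)) $ c" for i
  have D1: "\<bar>D i\<bar> \<le> 1" for i by (cases "e i $ c"; cases "e' i $ c") (simp_all add: D_def)
  have Dl: "\<bar>D l\<bar> = 1" using c by (cases "e l $ c"; cases "e' l $ c") (simp_all add: D_def)
  have "(\<lambda>i. s (i + l) *\<^sub>R (digit (e (i + l)) - digit (e' (i + l)))) sums (code_point s e - code_point s e')"
    by (rule code_point_diff_eq) (rule agree)
  then have "(\<lambda>i. (s (i + l) *\<^sub>R (digit (e (i + l)) - digit (e' (i + l)))) $ c) sums ((code_point s e - code_point s e') $ c)"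
    by (rule bounded_linear.sums[OF bounded_linear_vec_nth])
  then have "(\<lambda>i. s (i + l) * D (i + l)) sums ((code_point s e - code_point s e') $ c)"
    by (simp only: D_def vector_scaleR_component real_scaleR_def)
  then have "(\<lambda>i. s (Suc i + l) * D (Suc i + l)) sums ((code_point s e - code_point s e') $ c - s l * D l)"
    using sums_split_initial_segment[of "\<lambda>i. s (i + l) * D (i + l)" _ 1] by simp
  then have tail: "(\<lambda>i. s (i + Suc l) * D (i + Suc l)) sums ((code_point s e - code_point s e') $ c - s l * D l)" by simp
  have "norm (\<Sum>i. s (i + Suc l) * D (i + Suc l)) \<le> (\<Sum>i. s (i + Suc l))"
  proof (rule norm_suminf_le[OF _ summable_tail])
    show "norm (s (i + Suc l) * D (i + Suc l)) \<le> s (i + Suc l)" for i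
      using s_pos[of "i + Suc l"] mult_left_mono[OF D1[of "i + Suc l"], of "s (i + Suc l)"] by (simp add: abs_mult)
  qed
  then have "\<bar>(code_point s e - code_point s e') $ c - s l * D l\<bar> \<le> (\<Sum>i. s (i + Suc l))"
    using sums_unique[OF tail] by simp
  also have "\<dots> \<le> s (Suc l) / (1 - x)" by (rule suminf_tail_le)
  also have "\<dots> \<le> x * s l / (1 - x)" using s_Suc[of l] x by (intro divide_right_mono) auto
  finally have 1: "\<bar>(code_point s e - code_point s e') $ c - s l * D l\<bar> \<le> x * s l / (1 - x)" .
  have "\<bar>s l * D l\<bar> = s l" using Dl s_pos[of l] by (simp add: abs_mult)
  then have "\<bar>(code_point s e - code_point s e') $ c\<bar> \<ge> s l - x * s l / (1 - x)" using 1 by linarith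
  moreover have "s l - x * s l / (1 - x) = gap * s l"
  proof -
    have "1 = (1 - x) / (1 - x)" using x by simp
    then have "gap = 1 - x / (1 - x)" unfolding gap_def by (metis diff_divide_distrib diff_diff_eq mult_2)
    then show ?thesis by (metis left_diff_distrib mult_1 times_divide_eq_left)
  qed
  ultimately have "gap * s l \<le> dist (code_point s e) (code_point s e')"
    using component_le_norm_cart[of "code_point s e - code_point s e'" c] unfolding dist_norm by linarith
  moreover have "gap * s k \<le> gap * s l"
    using gap_pos s_antimono[of l k] \<open>l \<le> j\<close> assms(1) by (intro mult_left_mono) auto
  ultimately show ?thesis by linarith
qed

lemma code_point_separated:
  fixes e e' :: "nat \<Rightarrow> bool^'n::finite"
  assumes "dist (code_point s e) (code_point s e') < gap * s k"
  shows "\<forall>j\<le>k. e j = e' j"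
proof (intro allI impI, rule ccontr)
  fix j assume "j \<le> k" "e j \<noteq> e' j"
  then have "gap * s k \<le> dist (code_point s e) (code_point s e')" by (rule dist_code_point_ge)
  then show False using assms by simp
qed

lemma norm_code_point_le: "norm (code_point s e :: real^'n::finite) \<le> 2 * real CARD('n) * s 0"
proof -
  have "code_point s (\<lambda>_. \<chi> i. False) = (0 :: real^'n)"
    unfolding code_point_def digit_False scaleR_zero_right by (rule suminf_zero)
  moreover have "dist (code_point s e) (code_point s (\<lambda>_. \<chi> i. False)) \<le> 2 * real CARD('n) * s 0"
    by (rule dist_code_point_le) simp
  ultimately show ?thesis by (simp only: dist_0_norm dist_commute[of _ 0])
qed

text \<open>Prepares compactness of \<open>E\<close> as a continuous image of a product of finite
  discrete spaces. Fixing the first \<open>k\<close> digits is an open condition in the product and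
  confines the point to a ball of radius of order \<open>s k\<close>.\<close>

lemma continuous_map_code_point:
  "continuous_map (product_topology (\<lambda>_::nat. discrete_topology (UNIV :: (bool^'n::finite) set)) UNIV)
     euclidean (code_point s :: (nat \<Rightarrow> bool^'n) \<Rightarrow> real^'n)" (is "continuous_map ?T _ _")
  unfolding continuous_map_def
proof (intro conjI allI impI)
  fix U :: "(real^'n) set" assume "openin euclidean U"
  then have U: "open U" by simp
  have "\<exists>V. openin ?T V \<and> e \<in> V \<and> V \<subseteq> {e \<in> topspace ?T. code_point s e \<in> U}"
    if e: "code_point s e \<in> U" for e :: "nat \<Rightarrow> bool^'n"
  proof -
    obtain r where r: "r > 0" "ball (code_point s e) r \<subseteq> U" by (rule openE[OF U e])
    have "(\<lambda>k. 2 * real CARD('n) * s k) \<longlonglongrightarrow> 2 * real CARD('n) * 0"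
      by (intro tendsto_intros s_tendsto_0)
    then have "\<forall>\<^sub>F k in sequentially. 2 * real CARD('n) * s k < r"
      using r(1) by (intro order_tendstoD(2)) auto
    then obtain k where k: "2 * real CARD('n) * s k < r" unfolding eventually_sequentially by blast
    define V where "V = PiE UNIV (\<lambda>j. if j < k then {e j} else UNIV)"
    have "finite {j. (if j < k then {e j} else UNIV) \<noteq> (UNIV :: (bool^'n) set)}"
      by (rule finite_subset[of _ "{..<k}"]) auto
    then have "openin ?T V" unfolding V_def
      by (intro iffD2[OF openin_PiE_gen] disjI2 conjI ballI) (simp_all only: topspace_discrete_topology openin_discrete_topology subset_UNIV UNIV_I simp_thms Collect_mem_eq)
    moreover have "e \<in> V" unfolding V_def by (rule PiE_I) simp_all
    moreover have "code_point s e' \<in> U" if "e' \<in> V" for e'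
    proof -
      have "e j = e' j" if "j < k" for j
        using PiE_mem[OF \<open>e' \<in> V\<close>[unfolded V_def] UNIV_I, of j] that by (simp only: if_True singleton_iff)
      then have "dist (code_point s e) (code_point s e') \<le> 2 * real CARD('n) * s k"
        by (rule dist_code_point_le)
      then have "code_point s e' \<in> ball (code_point s e) r" using k by simp
      then show ?thesis using r(2) by blast
    qed
    ultimately show ?thesis by (intro exI[of _ V] conjI subsetI CollectI) simp_all
  qed
  then show "openin ?T {e \<in> topspace ?T. code_point s e \<in> U}"
    by (subst openin_subopen) simp
qed simp

lemma compact_range_code_point: "compact (range (code_point s :: (nat \<Rightarrow> bool^'n::finite) \<Rightarrow> real^'n))"
proof -
  let ?T = "product_topology (\<lambda>_::nat. discrete_topology (UNIV :: (bool^'n) set)) UNIV"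
  have "compact_space ?T"
    unfolding compact_space_product_topology by (simp add: compact_space_discrete_topology)
  then have "compactin euclidean (code_point s ` topspace ?T :: (real^'n) set)"
    unfolding compact_space_def by (rule image_compactin[OF _ continuous_map_code_point])
  then show ?thesis by simp
qed

end

section \<open>Integration by parts and cutoff functions\<close>

text \<open>Difference quotients of \<open>F\<close> integrate to zero because Lebesgue measure is
  translation invariant. They converge to \<open>D\<close> pointwise and, by the mean value theorem,
  are dominated by \<open>B\<close> on a fixed ball, so the limit integrates to zero as
  well.\<close>

lemma directional_derivative_integral_zero:
  fixes F D :: "'a::euclidean_space \<Rightarrow> real" and a :: 'a
  assumes cont: "continuous_on UNIV F"
    and der: "\<And>x. ((\<lambda>t. F (x + t *\<^sub>R a)) has_real_derivative D x) (at 0)"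
    and bd: "\<And>x. \<bar>D x\<bar> \<le> B" and supp: "\<And>x. norm x > R \<Longrightarrow> F x = 0"
  shows "integrable lborel D" "(\<integral>x. D x \<partial>lborel) = 0"
proof -
  define h where "h n = inverse (real (Suc n))" for n
  have h: "h n > 0" "h n \<le> 1" for n by (auto simp: h_def inverse_le_1_iff)
  have h0: "h \<longlonglongrightarrow> 0" unfolding h_def by (rule LIMSEQ_inverse_real_of_nat)
  define Q where "Q n x = (F (x + h n *\<^sub>R a) - F x) / h n" for n x
  \<comment> \<open>Applying the hypothesis at shifted base points gives the derivative along the
    whole line, as the mean value theorem needs it.\<close>
  have der': "((\<lambda>t. F (x + t *\<^sub>R a)) has_real_derivative D (x + t *\<^sub>R a)) (at t)" for x t
  proof -
    have "((\<lambda>s. F (x + (s + t) *\<^sub>R a)) has_real_derivative D (x + t *\<^sub>R a)) (at 0)"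
      using der[of "x + t *\<^sub>R a"] by (simp add: scaleR_add_left add_ac)
    then show ?thesis using DERIV_shift[of "\<lambda>t. F (x + t *\<^sub>R a)" "D (x + t *\<^sub>R a)" 0 t] by simp
  qed
  have B: "B \<ge> 0" using bd[of 0] by linarith
  \<comment> \<open>Enlarged by \<open>norm a\<close> because the steps satisfy
    \<open>h n \<le> 1\<close>: outside \<open>S\<close> both terms of every quotient
    \<open>Q n\<close> vanish. The absolute value covers a negative \<open>R\<close>.\<close>
  define S where "S = cball (0::'a) (\<bar>R\<bar> + norm a)"
  have meas_F: "F \<in> borel_measurable borel" using cont by (rule borel_measurable_continuous_onI)
  have int_F: "integrable lborel F"
  proof -
    have "integrable lborel (\<lambda>x. indicator S x *\<^sub>R F x)"
      using continuous_on_subset[OF cont] by (intro borel_integrable_compact) (simp_all add: S_def)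
    moreover have "indicator S x *\<^sub>R F x = F x" for x
    proof (cases "x \<in> S")
      case False
      then have "norm x > R" using norm_ge_zero[of a] unfolding S_def mem_cball dist_0_norm by linarith
      then show ?thesis using supp[of x] by simp
    qed simp
    ultimately show ?thesis by (simp only:)
  qed
  have meas_Q: "Q n \<in> borel_measurable lborel" for n
    unfolding Q_def using meas_F by measurable
  have lim: "(\<lambda>n. Q n x) \<longlonglongrightarrow> D x" for x
  proof -
    have 1: "((\<lambda>s. (F (x + s *\<^sub>R a) - F x) / s) \<longlongrightarrow> D x) (at 0)"
      using DERIV_D[OF der[of x]] by simp
    have "filterlim h (at 0) sequentially"
      unfolding filterlim_at using h h0 by (auto intro!: always_eventually simp: less_imp_neq[symmetric]) 
    from filterlim_compose[OF 1 this] show ?thesis by (simp add: Q_def)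
  qed
  have bound: "norm (Q n x) \<le> B * indicator S x" for n x
  proof (cases "x \<in> S")
    case True
    obtain z where z: "F (x + h n *\<^sub>R a) - F (x + 0 *\<^sub>R a) = (h n - 0) * D (x + z *\<^sub>R a)"
      using MVT2[of 0 "h n" "\<lambda>t. F (x + t *\<^sub>R a)" "\<lambda>t. D (x + t *\<^sub>R a)"] h(1)[of n] der' by blast
    then have "Q n x = D (x + z *\<^sub>R a)" using h(1)[of n] by (simp add: Q_def)
    then show ?thesis using bd[of "x + z *\<^sub>R a"] True by simp
  next
    case False
    then have nx: "norm x > \<bar>R\<bar> + norm a" by (simp add: S_def)
    have "norm (h n *\<^sub>R a) \<le> 1 * norm a" using h[of n] by (simp add: mult_left_le_one_le)
    moreover have "norm x \<le> norm (x + h n *\<^sub>R a) + norm (h n *\<^sub>R a)"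
      using norm_triangle_ineq4[of "x + h n *\<^sub>R a" "h n *\<^sub>R a"] by simp
    ultimately have "norm (x + h n *\<^sub>R a) > R" using nx by linarith
    moreover have "norm x > R" using nx norm_ge_zero[of a] by linarith
    ultimately have "Q n x = 0" using supp by (simp add: Q_def)
    then show ?thesis using False by simp
  qed
  have int_w: "integrable lborel (\<lambda>x. B * indicator S x :: real)"
    unfolding S_def using emeasure_lborel_cball_finite[of "0::'a"] by (intro integrable_mult_right) (simp add: integrable_indicator_iff)
  have meas_D: "D \<in> borel_measurable lborel"
    by (rule borel_measurable_LIMSEQ_metric[OF meas_Q lim])
  have AE: "AE x in lborel. (\<lambda>n. Q n x) \<longlonglongrightarrow> D x" "AE x in lborel. norm (Q n x) \<le> B * indicator S x" for n
    using lim bound by auto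
  show "integrable lborel D"
    by (rule integrable_dominated_convergence[OF meas_D meas_Q int_w AE])
  have "(\<lambda>n. \<integral>x. Q n x \<partial>lborel) \<longlonglongrightarrow> (\<integral>x. D x \<partial>lborel)"
    by (rule integral_dominated_convergence[OF meas_D meas_Q int_w AE])
  moreover have "(\<integral>x. Q n x \<partial>lborel) = 0" for n
  proof -
    let ?c = "h n *\<^sub>R a"
    have d: "distr lborel borel ((+) ?c) = (lborel :: 'a measure)" by (rule lborel_distr_plus)
    have "integrable (distr lborel borel ((+) ?c)) F" using int_F unfolding d .
    then have i: "integrable lborel (\<lambda>x. F (?c + x))"
      using meas_F by (subst (asm) integrable_distr_eq) auto
    have "(\<integral>x. F x \<partial>lborel) = (\<integral>x. F x \<partial>distr lborel borel ((+) ?c))" unfolding d ..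
    also have "\<dots> = (\<integral>x. F (?c + x) \<partial>lborel)" using meas_F by (intro integral_distr) auto
    finally have "(\<integral>x. F (?c + x) - F x \<partial>lborel) = 0"
      using Bochner_Integration.integral_diff[OF i int_F] by simp
    then show ?thesis by (simp add: Q_def add.commute)
  qed
  ultimately have "(\<lambda>n. 0) \<longlonglongrightarrow> (\<integral>x. D x \<partial>lborel)" by (simp only:)
  then show "(\<integral>x. D x \<partial>lborel) = 0" by (simp add: LIMSEQ_const_iff)
qed

lemma has_derivative_imp_directional:
  assumes "(f has_derivative f') (at x)"
  shows "((\<lambda>t. f (x + t *\<^sub>R a)) has_real_derivative f' a) (at 0)"
proof -
  have 1: "((\<lambda>t. x + t *\<^sub>R a) has_derivative (\<lambda>t. t *\<^sub>R a)) (at (0::real))"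
    by (auto intro!: derivative_eq_intros)
  have "((\<lambda>t. f (x + t *\<^sub>R a)) has_derivative (\<lambda>t. f' (t *\<^sub>R a))) (at 0)"
    using has_derivative_compose[OF 1, of f f'] assms by simp
  moreover have "f' (t *\<^sub>R a) = f' a * t" for t
    using linear_cmul[OF has_derivative_linear[OF assms]] by (simp add: mult.commute)
  ultimately show ?thesis by (simp add: has_field_derivative_def mult_commute_abs)
qed

lemma test_function_bounds:
  fixes \<psi> :: "real^'n::finite \<Rightarrow> real"
  assumes "test_function \<psi>"
  shows "continuous_on UNIV \<psi>" "continuous_on UNIV (partial_deriv j \<psi>)" "\<And>x. \<psi> differentiable (at x)"
    and "\<exists>B R. B \<ge> 0 \<and> R \<ge> 0 \<and> (\<forall>x. \<bar>\<psi> x\<bar> \<le> B \<and> \<bar>partial_deriv j \<psi> x\<bar> \<le> B) \<and>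
           (\<forall>x. norm x > R \<longrightarrow> \<psi> x = 0 \<and> partial_deriv j \<psi> x = 0)"
proof -
  have "Ck 1 \<psi>" and cpt: "compact (closure {x. \<psi> x \<noteq> 0})" using assms by (auto simp: test_function_def)
  then show c: "continuous_on UNIV \<psi>" and cp: "continuous_on UNIV (partial_deriv j \<psi>)"
    and "\<And>x. \<psi> differentiable (at x)" by auto
  obtain R where R: "\<And>x. x \<in> closure {x. \<psi> x \<noteq> 0} \<Longrightarrow> norm x \<le> R"
    using compact_imp_bounded[OF cpt] by (auto simp: bounded_iff)
  define S where "S = cball (0::real^'n) \<bar>R\<bar>"
  have z: "\<psi> x = 0" if "norm x > \<bar>R\<bar>" for x
  proof (rule ccontr)
    assume "\<psi> x \<noteq> 0"
    then have "x \<in> closure {x. \<psi> x \<noteq> 0}" by (intro subsetD[OF closure_subset]) simp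
    then show False using R[of x] that by simp
  qed
  have zp: "partial_deriv j \<psi> x = 0" if x: "norm x > \<bar>R\<bar>" for x
  proof -
    have o: "open (- S)" unfolding S_def by (intro open_Compl closed_cball)
    have xS: "x \<in> - S" using x by (simp add: S_def)
    have zS: "0 = \<psi> y" if "y \<in> - S" for y using z[of y] that by (simp add: S_def)
    have "(\<psi> has_derivative (\<lambda>_. 0)) (at x)"
      by (rule has_derivative_transform_within_open[OF has_derivative_const o xS zS])
    then have "frechet_derivative \<psi> (at x) = (\<lambda>_. 0)" by (rule frechet_derivative_at[symmetric])
    then show ?thesis by (simp add: partial_deriv_def)
  qed
  have "compact S" by (simp add: S_def)
  then have "bounded (\<psi> ` S)" "bounded (partial_deriv j \<psi> ` S)"
    using continuous_on_subset[OF c] continuous_on_subset[OF cp]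
    by (simp_all add: compact_imp_bounded compact_continuous_image)
  then have "\<exists>B1. \<forall>x\<in>S. \<bar>\<psi> x\<bar> \<le> B1" "\<exists>B2. \<forall>x\<in>S. \<bar>partial_deriv j \<psi> x\<bar> \<le> B2"
    unfolding bounded_iff by auto
  then obtain B1 B2 where B1: "\<And>x. x \<in> S \<Longrightarrow> \<bar>\<psi> x\<bar> \<le> B1" and B2: "\<And>x. x \<in> S \<Longrightarrow> \<bar>partial_deriv j \<psi> x\<bar> \<le> B2"
    by metis
  have "\<bar>\<psi> x\<bar> \<le> max 0 (max B1 B2) \<and> \<bar>partial_deriv j \<psi> x\<bar> \<le> max 0 (max B1 B2)" for x
  proof (cases "x \<in> S")
    case True
    then show ?thesis using B1[OF True] B2[OF True] by linarith
  next
    case False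
    then show ?thesis using z[of x] zp[of x] by (auto simp: S_def)
  qed
  then show "\<exists>B R. B \<ge> 0 \<and> R \<ge> 0 \<and> (\<forall>x. \<bar>\<psi> x\<bar> \<le> B \<and> \<bar>partial_deriv j \<psi> x\<bar> \<le> B) \<and>
           (\<forall>x. norm x > R \<longrightarrow> \<psi> x = 0 \<and> partial_deriv j \<psi> x = 0)"
    using z zp by (intro exI[of _ "max 0 (max B1 B2)"] exI[of _ "\<bar>R\<bar>"]) auto
qed

text \<open>The product \<open>w * \<psi>\<close> is continuous, vanishes far out and has a bounded
  directional derivative, so the integral of that derivative is zero. Integrability of
  \<open>g * \<psi>\<close> comes from the same source, as a difference of two integrable functions,
  since nothing but a bound is known about \<open>g\<close>.\<close>

lemma integral_by_parts_test_function:
  fixes w g :: "real^'n::finite \<Rightarrow> real"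
  assumes \<psi>: "test_function \<psi>"
    and w: "continuous_on UNIV w" "\<And>x. \<bar>w x\<bar> \<le> Bw" "\<And>x. \<bar>g x\<bar> \<le> Bg"
    and der: "\<And>x. ((\<lambda>t. w (x + t *\<^sub>R axis j 1)) has_real_derivative g x) (at 0)"
  shows "integrable lborel (\<lambda>x. w x * partial_deriv j \<psi> x)" "integrable lborel (\<lambda>x. g x * \<psi> x)"
    "(\<integral>x. w x * partial_deriv j \<psi> x \<partial>lborel) = - (\<integral>x. g x * \<psi> x \<partial>lborel)"
proof -
  note tf = test_function_bounds[OF \<psi>]
  obtain B R where BR: "B \<ge> 0" "R \<ge> 0" "\<And>x. \<bar>\<psi> x\<bar> \<le> B" "\<And>x. \<bar>partial_deriv j \<psi> x\<bar> \<le> B"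
    "\<And>x. norm x > R \<Longrightarrow> \<psi> x = 0" "\<And>x. norm x > R \<Longrightarrow> partial_deriv j \<psi> x = 0"
    using tf(4)[of j] by metis
  have der\<psi>: "((\<lambda>t. \<psi> (x + t *\<^sub>R axis j 1)) has_real_derivative partial_deriv j \<psi> x) (at 0)" for x
    unfolding partial_deriv_def
    by (rule has_derivative_imp_directional) (use tf(3)[of x] in \<open>simp add: frechet_derivative_works[symmetric]\<close>)
  let ?D = "\<lambda>x. g x * \<psi> x + w x * partial_deriv j \<psi> x"
  have bd: "\<bar>?D x\<bar> \<le> Bg * B + Bw * B" for x
  proof -
    have "\<bar>g x * \<psi> x\<bar> \<le> Bg * B" "\<bar>w x * partial_deriv j \<psi> x\<bar> \<le> Bw * B"
      using BR(3,4)[of x] w(2,3)[of x] unfolding abs_mult by (auto intro!: mult_mono)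
    then show ?thesis by linarith
  qed
  have D: "((\<lambda>t. w (x + t *\<^sub>R axis j 1) * \<psi> (x + t *\<^sub>R axis j 1)) has_real_derivative ?D x) (at 0)" for x
    using DERIV_mult[OF der[of x] der\<psi>[of x]] by (simp add: mult.commute add.commute)
  have cw: "continuous_on UNIV (\<lambda>x. w x * \<psi> x)" by (intro continuous_intros w tf)
  have Z: "w x * \<psi> x = 0" if "norm x > R" for x using BR(5)[OF that] by simp
  note main = directional_derivative_integral_zero[of "\<lambda>x. w x * \<psi> x" "axis j 1" ?D _ R, OF cw D bd Z]
  show i1: "integrable lborel (\<lambda>x. w x * partial_deriv j \<psi> x)"
  proof -
    have "integrable lborel (\<lambda>x. indicator (cball 0 R) x *\<^sub>R (w x * partial_deriv j \<psi> x))"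
      by (intro borel_integrable_compact continuous_intros continuous_on_subset[OF w(1)] continuous_on_subset[OF tf(2)]) auto
    moreover have "indicator (cball 0 R) x *\<^sub>R (w x * partial_deriv j \<psi> x) = w x * partial_deriv j \<psi> x" for x
      using BR(6)[of x] by (cases "x \<in> cball 0 R") auto
    ultimately show ?thesis by (simp only:)
  qed
  show i2: "integrable lborel (\<lambda>x. g x * \<psi> x)"
    using Bochner_Integration.integrable_diff[OF main(1) i1] by simp
  show "(\<integral>x. w x * partial_deriv j \<psi> x \<partial>lborel) = - (\<integral>x. g x * \<psi> x \<partial>lborel)"
    using main(2) Bochner_Integration.integral_add[OF i2 i1] by simp
qed

section \<open>A continuously differentiable step and logarithmic cutoffs\<close>

lemma DERIV_max_0_power2: "((\<lambda>t. (max 0 t)\<^sup>2) has_real_derivative 2 * max 0 t) (at (t::real))"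
proof -
  have b: "norm (((max 0 (t + h))\<^sup>2 - (max 0 t)\<^sup>2) / h - 2 * max 0 t) \<le> norm h" if "h \<noteq> 0" for h
  proof -
    have "\<bar>(max 0 (t + h))\<^sup>2 - (max 0 t)\<^sup>2 - 2 * max 0 t * h\<bar> \<le> h\<^sup>2"
    proof -
      consider "t \<ge> 0" "t + h \<ge> 0" | "t \<ge> 0" "t + h < 0" | "t < 0" "t + h \<ge> 0" | "t < 0" "t + h < 0" by linarith
      then show ?thesis
      proof cases
        case 1 then show ?thesis by (simp add: power2_eq_square algebra_simps)
      next
        case 2
        have "0 \<le> t * (- 2 * h - t)" using 2 by (intro mult_nonneg_nonneg) auto
        moreover have "0 \<le> (t + h)\<^sup>2" by simp
        ultimately show ?thesis using 2 by (simp add: max_def power2_eq_square algebra_simps)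
      next
        case 3
        have "(t + h)\<^sup>2 \<le> h\<^sup>2" using 3 by (intro power_mono) auto
        then show ?thesis using 3 by (simp add: max_def)
      next
        case 4 then show ?thesis by (simp add: max_def)
      qed
    qed
    moreover have "((max 0 (t + h))\<^sup>2 - (max 0 t)\<^sup>2) / h - 2 * max 0 t
        = ((max 0 (t + h))\<^sup>2 - (max 0 t)\<^sup>2 - 2 * max 0 t * h) / h"
      using that by (simp add: diff_divide_distrib)
    moreover have "h\<^sup>2 / \<bar>h\<bar> = \<bar>h\<bar>" using that by (simp add: power2_eq_square abs_if)
    ultimately show ?thesis
      using that by (metis abs_divide abs_ge_zero divide_right_mono real_norm_def)
  qed
  have "((\<lambda>h. ((max 0 (t + h))\<^sup>2 - (max 0 t)\<^sup>2) / h - 2 * max 0 t) \<longlongrightarrow> 0) (at 0)"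
  proof (rule Lim_null_comparison)
    show "\<forall>\<^sub>F h in at 0. norm (((max 0 (t + h))\<^sup>2 - (max 0 t)\<^sup>2) / h - 2 * max 0 t) \<le> norm h"
      unfolding eventually_at_filter using b by (intro always_eventually allI impI) 
    show "(norm \<longlongrightarrow> 0) (at (0::real))" by (rule tendsto_norm_zero) (rule tendsto_ident_at)
  qed
  then show ?thesis unfolding DERIV_def LIM_zero_iff .
qed

text \<open>The antiderivative of a tent of height 2 over the unit interval, written with truncated
  squares. Piecewise quadratic rather than piecewise linear, so that the cutoffs are differentiable
  at every point, as the integration by parts above demands.\<close>

definition smooth_step :: "real \<Rightarrow> real" where
  "smooth_step t = 2 * ((max 0 t)\<^sup>2 - 2 * (max 0 (t - 1/2))\<^sup>2 + (max 0 (t - 1))\<^sup>2)"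

definition smooth_step' :: "real \<Rightarrow> real" where
  "smooth_step' t = 4 * (max 0 t - 2 * max 0 (t - 1/2) + max 0 (t - 1))"

lemma DERIV_smooth_step: "(smooth_step has_real_derivative smooth_step' t) (at t)"
proof -
  have D: "((\<lambda>t. (max 0 (t - c))\<^sup>2) has_real_derivative 2 * max 0 (t - c)) (at t)" for c
    using DERIV_shift[of "\<lambda>t. (max 0 t)\<^sup>2" "2 * max 0 (t - c)" t "- c"] DERIV_max_0_power2[of "t - c"] by simp
  show ?thesis
    unfolding smooth_step_def[abs_def] smooth_step'_def
    by (rule derivative_eq_intros DERIV_max_0_power2 D refl)+ simp
qed

lemma smooth_step'_nonneg: "0 \<le> smooth_step' t" and smooth_step'_le_2: "smooth_step' t \<le> 2"
  by (auto simp: smooth_step'_def max_def)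

lemma smooth_step'_eq_0: "t \<le> 0 \<or> t \<ge> 1 \<Longrightarrow> smooth_step' t = 0"
  by (auto simp: smooth_step'_def max_def)

lemma smooth_step_eq_0: "t \<le> 0 \<Longrightarrow> smooth_step t = 0"
  by (simp add: smooth_step_def max_def)

lemma smooth_step_eq_1: "t \<ge> 1 \<Longrightarrow> smooth_step t = 1"
  by (simp add: smooth_step_def max_def power2_eq_square algebra_simps)

lemma smooth_step_bounds: "0 \<le> smooth_step t" "smooth_step t \<le> 1"
proof -
  have m: "smooth_step a \<le> smooth_step b" if "a \<le> b" for a b
    using that by (rule DERIV_nonneg_imp_nondecreasing) (blast intro: DERIV_smooth_step smooth_step'_nonneg)
  show "0 \<le> smooth_step t" using m[of "min t 0" t] smooth_step_eq_0[of "min t 0"] by simp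
  show "smooth_step t \<le> 1" using m[of t "max t 1"] smooth_step_eq_1[of "max t 1"] by simp
qed

text \<open>A cutoff interpolating on the logarithmic scale between the radii \<open>exp (- l - d)\<close> and \<open>exp (- l)\<close>.\<close>

definition log_bump :: "real \<Rightarrow> real \<Rightarrow> 'a::euclidean_space \<Rightarrow> real" where
  "log_bump l d y = (if y = 0 then 1 else smooth_step ((- ln (norm y) - l) / d))"

text \<open>Chain rule with \<open>- y / (norm y)\<^sup>2\<close> as the gradient of
  \<open>- ln (norm y)\<close>. The value at the origin is 0, which is correct because the cutoff is
  constant nearby.\<close>

definition log_bump_grad :: "real \<Rightarrow> real \<Rightarrow> 'a::euclidean_space \<Rightarrow> 'a" where
  "log_bump_grad l d y = (- smooth_step' ((- ln (norm y) - l) / d) / (d * (norm y)\<^sup>2)) *\<^sub>R y"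

lemma log_bump_bounds: "0 \<le> log_bump l d y" "log_bump l d y \<le> 1"
  using smooth_step_bounds by (auto simp: log_bump_def)

lemma log_bump_eq_0:
  assumes "d > 0" "norm y \<ge> exp (- l)"
  shows "log_bump l d y = 0"
proof -
  have y: "norm y > 0" using assms(2) exp_gt_zero[of "- l"] by linarith
  then have "- l \<le> ln (norm y)" using assms(2) by (simp add: ln_ge_iff)
  then have "(- ln (norm y) - l) / d \<le> 0" using assms(1) by (intro divide_nonpos_pos) auto
  then show ?thesis using y by (auto simp: log_bump_def smooth_step_eq_0)
qed

lemma log_bump_eq_1:
  assumes "d > 0" "norm y \<le> exp (- (l + d))"
  shows "log_bump l d y = 1"
proof (cases "y = 0")
  case False
  then have "ln (norm y) \<le> - (l + d)" using assms(2) ln_mono[of "norm y" "exp (- (l + d))"] by simp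
  then have "(- ln (norm y) - l) / d \<ge> 1" using assms(1) by (simp add: pos_le_divide_eq)
  then show ?thesis using False by (auto simp: log_bump_def smooth_step_eq_1)
qed (simp add: log_bump_def)

lemma log_bump_grad_eq_0:
  assumes "d > 0" "norm y \<ge> exp (- l) \<or> norm y \<le> exp (- (l + d))"
  shows "log_bump_grad l d y = 0"
proof (cases "y = 0")
  case False
  then have y: "norm y > 0" by simp
  have "(- ln (norm y) - l) / d \<le> 0 \<or> (- ln (norm y) - l) / d \<ge> 1"
    using assms(2)
  proof
    assume "norm y \<ge> exp (- l)"
    then have "- l \<le> ln (norm y)" using y by (simp add: ln_ge_iff)
    then have "(- ln (norm y) - l) / d \<le> 0" using assms(1) by (intro divide_nonpos_pos) auto
    then show ?thesis ..
  next
    assume "norm y \<le> exp (- (l + d))"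
    then have "ln (norm y) \<le> - (l + d)" using y ln_mono[of "norm y" "exp (- (l + d))"] by simp
    then have "(- ln (norm y) - l) / d \<ge> 1" using assms(1) by (simp add: pos_le_divide_eq)
    then show ?thesis ..
  qed
  then show ?thesis by (simp add: log_bump_grad_def smooth_step'_eq_0)
qed (simp add: log_bump_grad_def)

lemma norm_log_bump_grad_le:
  assumes "d > 0"
  shows "norm (log_bump_grad l d y) \<le> 2 / d / norm y"
proof (cases "y = 0")
  case False
  have "norm (log_bump_grad l d y) = smooth_step' ((- ln (norm y) - l) / d) / d / norm y"
    using assms False smooth_step'_nonneg[of "(- ln (norm y) - l) / d"]
    by (simp add: log_bump_grad_def abs_mult power2_eq_square)
  also have "\<dots> \<le> 2 / d / norm y"
    using assms smooth_step'_le_2 by (intro divide_right_mono) auto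
  finally show ?thesis .
qed (simp add: log_bump_grad_def)

text \<open>The singularity of \<open>1 / norm y\<close> is never reached, since the gradient
  vanishes up to radius \<open>exp (- (l + d))\<close>. This crude uniform bound serves only
  integration by parts; the energy estimate uses the sharper pointwise one.\<close>

lemma norm_log_bump_grad_bound:
  assumes "d > 0"
  shows "norm (log_bump_grad l d y) \<le> 2 / d * exp (l + d)"
proof (cases "norm y \<le> exp (- (l + d))")
  case True
  then show ?thesis using log_bump_grad_eq_0[OF assms, of l y] assms by simp
next
  case False
  then have "inverse (norm y) \<le> inverse (exp (- (l + d)))" by (intro le_imp_inverse_le) auto
  then have "inverse (norm y) \<le> exp (l + d)" by (simp only: exp_minus inverse_inverse_eq)
  then have "2 / d * inverse (norm y) \<le> 2 / d * exp (l + d)" using assms by (intro mult_left_mono) auto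
  then show ?thesis using norm_log_bump_grad_le[OF assms, of l y] by (simp add: divide_inverse)
qed

lemma has_derivative_log_bump:
  assumes d: "d > 0"
  shows "(log_bump l d has_derivative (\<lambda>h. log_bump_grad l d y \<bullet> h)) (at y)"
proof (cases "y = 0")
  case True
  have o: "open (ball (0::'a) (exp (- (l + d))))" by simp
  have y: "y \<in> ball 0 (exp (- (l + d)))" using True by simp
  have e: "1 = log_bump l d z" if "z \<in> ball 0 (exp (- (l + d)))" for z
    using log_bump_eq_1[OF d, of z l] that by simp
  have "(log_bump l d has_derivative (\<lambda>h. 0)) (at y)"
    by (rule has_derivative_transform_within_open[OF has_derivative_const o y e])
  then show ?thesis using True by (simp add: log_bump_grad_def)
next
  case False
  let ?t = "\<lambda>z::'a. (- ln (norm z) - l) / d"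
  have "((\<lambda>z. norm z) has_derivative (\<lambda>h. (y \<bullet> h) / norm y)) (at y)"
    using has_derivative_norm[OF False] by (simp add: sgn_div_norm inner_commute divide_inverse mult.commute)
  then have "(?t has_derivative (\<lambda>h. - ((y \<bullet> h) / norm y / norm y) / d)) (at y)"
    using False d by (auto intro!: derivative_eq_intros simp: divide_inverse)
  from DERIV_compose_FDERIV[OF DERIV_smooth_step this]
  have "((\<lambda>z. smooth_step (?t z)) has_derivative (\<lambda>h. - ((y \<bullet> h) / norm y / norm y) / d * smooth_step' (?t y))) (at y)" .
  moreover have "(\<lambda>h. - ((y \<bullet> h) / norm y / norm y) / d * smooth_step' (?t y)) = (\<lambda>h. log_bump_grad l d y \<bullet> h)"
    by (simp add: fun_eq_iff log_bump_grad_def power2_eq_square divide_inverse mult_ac)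
  ultimately have "((\<lambda>z. smooth_step (?t z)) has_derivative (\<lambda>h. log_bump_grad l d y \<bullet> h)) (at y)" by (simp only:)
  moreover have "open (- {0::'a})" by (intro open_Compl closed_singleton)
  ultimately show ?thesis
    by (rule has_derivative_transform_within_open) (use False in \<open>simp_all add: log_bump_def\<close>)
qed

lemma continuous_on_log_bump: "d > 0 \<Longrightarrow> continuous_on UNIV (log_bump l d)"
  by (meson continuous_at_imp_continuous_on has_derivative_continuous has_derivative_log_bump)

lemma borel_measurable_log_bump_grad: "log_bump_grad l d \<in> borel_measurable borel"
proof -
  have [measurable]: "smooth_step' \<in> borel_measurable borel"
    unfolding smooth_step'_def[abs_def] by measurable
  show ?thesis unfolding log_bump_grad_def[abs_def] by measurable
qed

section \<open>Series in Orlicz--Sobolev spaces\<close>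

lemma young_scale:
  assumes "young_function A" "0 \<le> c" "c \<le> 1" "0 \<le> t"
  shows "A (c * t) \<le> c * A t"
proof -
  have c: "convex_on {0..} A" and "A 0 = 0" using assms(1) by (auto simp: young_function_def)
  have "A ((1 - c) *\<^sub>R 0 + c *\<^sub>R t) \<le> (1 - c) * A 0 + c * A t"
    by (rule convex_onD[OF c]) (use assms in auto)
  then show ?thesis using \<open>A 0 = 0\<close> by simp
qed

lemma young_nonneg: "young_function A \<Longrightarrow> 0 \<le> t \<Longrightarrow> 0 \<le> A t"
  by (simp add: young_function_def)

lemma young_mono:
  assumes A: "young_function A" and "0 \<le> s" "s \<le> t"
  shows "A s \<le> A t"
proof (cases "t = 0")
  case False
  then have t: "t > 0" using assms by linarith
  have st: "0 \<le> s / t" "s / t \<le> 1" using assms t by auto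
  have "A s = A (s / t * t)" using t by simp
  also have "\<dots> \<le> s / t * A t" using young_scale[OF A st, of t] t by simp
  also have "\<dots> \<le> 1 * A t" using st young_nonneg[OF A, of t] t by (intro mult_right_mono) auto
  finally show ?thesis by simp
qed (use assms in simp)

text \<open>Jensen's inequality for total weight at most 1: the missing weight is given to an extra
  index \<open>K\<close> with value 0, where \<open>A\<close> vanishes.\<close>

lemma young_sum:
  fixes K :: nat and a t :: "nat \<Rightarrow> real"
  assumes A: "young_function A" and a: "\<And>k. 0 \<le> a k" "(\<Sum>k<K. a k) \<le> 1" and t: "\<And>k. 0 \<le> t k"
  shows "A (\<Sum>k<K. a k * t k) \<le> (\<Sum>k<K. a k * A (t k))"
proof -
  have c: "convex_on {0..} A" and A0: "A 0 = 0" using A by (auto simp: young_function_def)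
  define a' where "a' k = (if k < K then a k else 1 - (\<Sum>k<K. a k))" for k
  define t' where "t' k = (if k < K then t k else 0)" for k
  have "A (\<Sum>k\<le>K. a' k *\<^sub>R t' k) \<le> (\<Sum>k\<le>K. a' k * A (t' k))"
  proof (rule convex_on_sum[OF _ _ c])
    have "(\<Sum>k\<le>K. a' k) = (\<Sum>k<K. a' k) + a' K" by (simp add: lessThan_Suc_atMost[symmetric])
    also have "(\<Sum>k<K. a' k) = (\<Sum>k<K. a k)" by (intro sum.cong) (auto simp: a'_def)
    finally show "(\<Sum>k\<le>K. a' k) = 1" by (simp add: a'_def)
    show "0 \<le> a' k" if "k \<in> {..K}" for k using a by (simp add: a'_def)
    show "t' k \<in> {0..}" if "k \<in> {..K}" for k using t by (simp add: t'_def)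
  qed auto
  moreover have "(\<Sum>k\<le>K. a' k *\<^sub>R t' k) = (\<Sum>k<K. a k * t k)"
  proof -
    have "(\<Sum>k\<le>K. a' k *\<^sub>R t' k) = (\<Sum>k<K. a' k *\<^sub>R t' k) + a' K *\<^sub>R t' K"
      by (simp add: lessThan_Suc_atMost[symmetric])
    also have "(\<Sum>k<K. a' k *\<^sub>R t' k) = (\<Sum>k<K. a k * t k)" by (intro sum.cong) (auto simp: a'_def t'_def)
    finally show ?thesis by (simp add: t'_def)
  qed
  moreover have "(\<Sum>k\<le>K. a' k * A (t' k)) = (\<Sum>k<K. a k * A (t k))"
  proof -
    have "(\<Sum>k\<le>K. a' k * A (t' k)) = (\<Sum>k<K. a' k * A (t' k)) + a' K * A (t' K)"
      by (simp add: lessThan_Suc_atMost[symmetric])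
    also have "(\<Sum>k<K. a' k * A (t' k)) = (\<Sum>k<K. a k * A (t k))" by (intro sum.cong) (auto simp: a'_def t'_def)
    finally show ?thesis by (simp add: t'_def A0)
  qed
  ultimately show ?thesis by simp
qed

text \<open>Convex functions are continuous on open intervals, here the positive half-line. A limit
  equal to 0 is treated separately where this is applied.\<close>

lemma young_tendsto:
  assumes A: "young_function A" and t: "t > 0" and x: "x \<longlonglongrightarrow> t"
  shows "(\<lambda>n. A (x n)) \<longlonglongrightarrow> A t"
proof -
  have "convex_on {0..} A" using A by (simp add: young_function_def)
  then have "convex_on {0<..} A" by (rule convex_on_subset) auto
  then have "continuous_on {0<..} A" by (rule convex_on_continuous[OF open_greaterThan])
  then have "isCont A t" using t continuous_on_eq_continuous_at[OF open_greaterThan[of 0], of A] by (simp only: greaterThan_iff Ball_def)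
  then show ?thesis by (rule isCont_tendsto_compose) (rule x)
qed

lemma borel_measurable_vec_component:
  fixes f :: "'a \<Rightarrow> ('b::real_normed_vector)^'n::finite"
  assumes "f \<in> borel_measurable M"
  shows "(\<lambda>x. f x $ i) \<in> borel_measurable M"
  by (rule measurable_compose[OF assms borel_measurable_continuous_onI]) (intro continuous_intros)

text \<open>Jensen's inequality reduces the Orlicz bound for the series to a bound that is uniform
  over its terms. Each \<open>M k\<close> dominates two things at once: \<open>norm (F k x)\<close>,
  which makes the gradient series integrable and allows termwise integration, and
  \<open>A (norm (F k x))\<close>, which controls the Orlicz norm.\<close>

lemma V1A_suminf:
  fixes f :: "nat \<Rightarrow> real^'n::finite \<Rightarrow> real^'n" and F :: "nat \<Rightarrow> real^'n \<Rightarrow> real^'n^'n"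
    and a :: "nat \<Rightarrow> real" and M :: "nat \<Rightarrow> real^'n \<Rightarrow> real"
  assumes A: "young_function A"
    and a: "\<And>k. 0 \<le> a k" "summable a" "(\<Sum>k. a k) \<le> 1"
    and f: "\<And>k. continuous_on UNIV (f k)" "\<And>k x. norm (f k x) \<le> B"
    and F: "\<And>k. F k \<in> borel_measurable borel"
    and parts: "\<And>k \<psi> i j. test_function \<psi> \<Longrightarrow>
       (\<integral>x. f k x $ i * partial_deriv j \<psi> x \<partial>lborel) = - (\<integral>x. F k x $ i $ j * \<psi> x \<partial>lborel)"
    and M: "\<And>k. M k \<in> borel_measurable borel" "\<And>k x. norm (F k x) \<le> M k x" "\<And>k x. A (norm (F k x)) \<le> M k x"
      "\<And>k. (\<integral>\<^sup>+x. ennreal (M k x) \<partial>lborel) \<le> ennreal C"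
  shows "(\<lambda>x. \<Sum>k. a k *\<^sub>R f k x) \<in> V1A A" "continuous_on UNIV (\<lambda>x. \<Sum>k. a k *\<^sub>R f k x)"
proof -
  define u where "u x = (\<Sum>k. a k *\<^sub>R f k x)" for x
  define G where "G x = (\<Sum>k. a k *\<^sub>R F k x)" for x
  \<comment> \<open>As a series in \<open>ennreal\<close> this makes sense everywhere; its finite
    integral then yields convergence of the real series almost everywhere.\<close>
  define S where "S x = (\<Sum>k. ennreal (a k * M k x))" for x
  have M0: "0 \<le> M k x" for k x by (rule order_trans[OF norm_ge_zero M(2)])
  have aM0: "0 \<le> a k * M k x" for k x using a(1) M0 by simp
  have B0: "B \<ge> 0" by (rule order_trans[OF norm_ge_zero f(2)])
  have sa: "summable (\<lambda>k. a k * c)" for c using a(2) by (rule summable_mult2)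
  have bf: "norm (a k *\<^sub>R f k x) \<le> a k * B" for k x
    using a(1)[of k] f(2)[of k x] by (simp add: mult_left_mono)
  have sf: "summable (\<lambda>k. a k *\<^sub>R f k x)" for x
    by (rule summable_comparison_test'[OF sa[of B], of 0]) (rule bf)
  have cu: "continuous_on UNIV u"
  proof (rule uniform_limit_theorem)
    show "uniform_limit UNIV (\<lambda>n x. \<Sum>k<n. a k *\<^sub>R f k x) u sequentially"
      unfolding u_def by (rule Weierstrass_m_test[OF bf sa])
    show "\<forall>\<^sub>F n in sequentially. continuous_on UNIV (\<lambda>x. \<Sum>k<n. a k *\<^sub>R f k x)"
      by (intro always_eventually allI continuous_intros f)
  qed simp
  have [measurable]: "S \<in> borel_measurable borel" unfolding S_def using M(1) by measurable
  \<comment> \<open>The maximum with 1 matters later: this number becomes the Luxemburg constant,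
    and \<open>young_scale\<close> can divide only by numbers that are at least 1.\<close>
  have int_S: "(\<integral>\<^sup>+x. S x \<partial>lborel) \<le> ennreal (max 1 C)"
  proof -
    have "(\<integral>\<^sup>+x. S x \<partial>lborel) = (\<Sum>k. \<integral>\<^sup>+x. ennreal (a k * M k x) \<partial>lborel)"
      unfolding S_def using M(1) by (intro nn_integral_suminf) measurable
    also have "\<dots> \<le> (\<Sum>k. ennreal (a k * max 1 C))"
    proof (intro suminf_le allI)
      fix k
      have "(\<integral>\<^sup>+x. ennreal (a k * M k x) \<partial>lborel) = ennreal (a k) * (\<integral>\<^sup>+x. ennreal (M k x) \<partial>lborel)"
        using M(1)[of k] a(1)[of k] M0 by (simp add: ennreal_mult nn_integral_cmult)
      also have "\<dots> \<le> ennreal (a k) * ennreal (max 1 C)"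
        by (intro mult_left_mono order_trans[OF M(4)] ennreal_leI) auto
      also have "\<dots> = ennreal (a k * max 1 C)" using a(1)[of k] by (simp add: ennreal_mult')
      finally show "(\<integral>\<^sup>+x. ennreal (a k * M k x) \<partial>lborel) \<le> ennreal (a k * max 1 C)" .
    qed auto
    also have "\<dots> = ennreal (\<Sum>k. a k * max 1 C)"
      using a(1) by (intro suminf_ennreal2 sa) simp
    also have "(\<Sum>k. a k * max 1 C) = (\<Sum>k. a k) * max 1 C" by (rule suminf_mult2[symmetric, OF a(2)])
    also have "ennreal \<dots> \<le> ennreal (1 * max 1 C)" by (intro ennreal_leI mult_right_mono a(3)) simp
    finally show ?thesis by simp
  qed
  have AE_sum: "AE x in lborel. summable (\<lambda>k. a k * M k x)"
  proof -
    have "AE x in lborel. S x \<noteq> \<infinity>"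
      using int_S by (intro nn_integral_PInf_AE) (auto simp: top_unique)
    then show ?thesis
    proof eventually_elim
      case (elim x)
      then show ?case using summable_suminf_not_top[of "\<lambda>k. a k * M k x"] aM0 by (simp add: S_def)
    qed
  qed
  have int_M: "integrable lborel (M k)" for k
  proof (rule integrableI_bounded)
    have "(\<integral>\<^sup>+x. ennreal (norm (M k x)) \<partial>lborel) \<le> ennreal C" using M(4)[of k] M0 by simp
    then show "(\<integral>\<^sup>+x. ennreal (norm (M k x)) \<partial>lborel) < \<infinity>" by (rule le_less_trans) simp
  qed (use M(1) in simp)
  have le_C: "(\<integral>x. M k x \<partial>lborel) \<le> max 0 C" for k
  proof -
    have "ennreal (\<integral>x. M k x \<partial>lborel) \<le> ennreal (max 0 C)"
    proof -
      have "ennreal (\<integral>x. M k x \<partial>lborel) = (\<integral>\<^sup>+x. ennreal (M k x) \<partial>lborel)"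
        by (rule nn_integral_eq_integral[symmetric, OF int_M]) (simp add: M0)
      also have "\<dots> \<le> ennreal (max 0 C)" by (rule order_trans[OF M(4) ennreal_leI]) simp
      finally show ?thesis .
    qed
    then show ?thesis by (subst (asm) ennreal_le_iff) auto
  qed
  have bF: "norm (a k *\<^sub>R F k x) \<le> a k * M k x" for k x
    using a(1)[of k] M(2)[of k x] by (simp add: mult_left_mono)
  have int_F: "integrable lborel (F k)" for k
  proof (rule Bochner_Integration.integrable_bound[OF int_M[of k]])
    show "AE x in lborel. norm (F k x) \<le> norm (M k x)" using M(2)[of k] M0[of k] by simp
  qed (use F in simp)
  have AE_sF: "AE x in lborel. summable (\<lambda>k. norm (a k *\<^sub>R F k x))"
    using AE_sum
  proof eventually_elim
    case (elim x)
    show ?case by (rule summable_comparison_test'[OF elim, of 0]) (use bF in simp)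
  qed
  have int_aM: "integrable lborel (\<lambda>x. a k * M k x)" for k using int_M by simp
  have aM_C: "(\<integral>x. a k * M k x \<partial>lborel) \<le> a k * max 0 C" for k
    using le_C[of k] a(1)[of k] by (simp add: mult_left_mono)
  have int_G: "integrable lborel G"
    unfolding G_def
  proof (rule integrable_suminf[OF _ AE_sF])
    show "summable (\<lambda>k. \<integral>x. norm (a k *\<^sub>R F k x) \<partial>lborel)"
    proof (rule summable_comparison_test'[OF sa[of "max 0 C"], of 0])
      fix k
      have "(\<integral>x. norm (a k *\<^sub>R F k x) \<partial>lborel) \<le> (\<integral>x. a k * M k x \<partial>lborel)"
        by (rule integral_mono[OF integrable_norm[OF integrable_scaleR_right[OF int_F]] int_aM bF])
      then show "norm (\<integral>x. norm (a k *\<^sub>R F k x) \<partial>lborel) \<le> a k * max 0 C"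
        using aM_C[of k] by simp
    qed
  qed (use int_F in simp)
  have loc_u: "locally_integrable u"
    unfolding locally_integrable_def set_integrable_def
  proof (intro allI impI)
    fix K :: "(real^'n) set" assume K: "compact K"
    have "integrable lborel (\<lambda>x. indicator K x *\<^sub>R u x)"
      by (rule borel_integrable_compact[OF K continuous_on_subset[OF cu]]) simp
    then show "integrable lebesgue (\<lambda>x. indicator K x *\<^sub>R u x)"
      by (subst integrable_completion) (auto dest: borel_measurable_integrable)
  qed
  have int_G': "integrable lebesgue G"
    using int_G by (subst integrable_completion) (auto dest: borel_measurable_integrable)
  have loc_G: "locally_integrable G"
    unfolding locally_integrable_def set_integrable_def
    by (intro allI impI integrable_mult_indicator int_G') (simp add: compact_imp_closed)
  have G_meas: "G \<in> borel_measurable lborel" using int_G by (rule borel_measurable_integrable)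
  have u_meas: "u \<in> borel_measurable borel" using cu by (rule borel_measurable_continuous_onI)
  \<comment> \<open>Integration by parts holds termwise. The two exchanges of sum and integral are
    dominated by \<open>a k * (B * \<bar>partial_deriv j \<psi> x\<bar>)\<close> and by
    \<open>b * (a k * M k x)\<close>, both summable after integration.\<close>
  have weak: "(\<integral>x. u x $ i * partial_deriv j \<psi> x \<partial>lebesgue) = - (\<integral>x. G x $ i $ j * \<psi> x \<partial>lebesgue)"
    if \<psi>: "test_function \<psi>" for \<psi> i j
  proof -
    note tf = test_function_bounds[OF \<psi>]
    obtain b R where bR: "b \<ge> 0" "\<And>x. \<bar>\<psi> x\<bar> \<le> b" "\<And>x. norm x > R \<Longrightarrow> partial_deriv j \<psi> x = 0"
      using tf(4)[of j] by metis
    have \<psi>m: "\<psi> \<in> borel_measurable borel" "partial_deriv j \<psi> \<in> borel_measurable borel"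
      using tf(1,2) by (auto intro: borel_measurable_continuous_onI)
    let ?p = "partial_deriv j \<psi>"
    have int_p: "integrable lborel ?p"
    proof -
      have "integrable lborel (\<lambda>x. indicator (cball 0 R) x *\<^sub>R ?p x)"
        by (intro borel_integrable_compact continuous_on_subset[OF tf(2)]) auto
      moreover have "indicator (cball 0 R) x *\<^sub>R ?p x = ?p x" for x
        using bR(3)[of x] by (cases "x \<in> cball 0 R") auto
      ultimately show ?thesis by (simp only:)
    qed
    have fi: "\<bar>f k x $ i\<bar> \<le> B" for k x using component_le_norm_cart[of "f k x" i] f(2)[of k x] by linarith
    have fm: "(\<lambda>x. f k x $ i) \<in> borel_measurable borel" for k
      using f(1)[of k] by (intro borel_measurable_continuous_onI continuous_intros)
    have b1: "norm (a k * (f k x $ i * ?p x)) \<le> a k * (B * \<bar>?p x\<bar>)" for k x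
    proof -
      have "\<bar>f k x $ i\<bar> * \<bar>?p x\<bar> \<le> B * \<bar>?p x\<bar>" by (rule mult_right_mono[OF fi]) simp
      then have "a k * (\<bar>f k x $ i\<bar> * \<bar>?p x\<bar>) \<le> a k * (B * \<bar>?p x\<bar>)" using a(1)[of k] by (rule mult_left_mono)
      then show ?thesis using a(1)[of k] by (simp add: abs_mult)
    qed
    have int1: "integrable lborel (\<lambda>x. B * \<bar>?p x\<bar>)" using int_p by simp
    have int1k: "integrable lborel (\<lambda>x. f k x $ i * ?p x)" for k
    proof (rule Bochner_Integration.integrable_bound[OF int1])
      have "norm (f k x $ i * ?p x) \<le> norm (B * \<bar>?p x\<bar>)" for x
        using mult_right_mono[OF fi[of k x], of "\<bar>?p x\<bar>"] B0 by (simp add: abs_mult)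
      then show "AE x in lborel. norm (f k x $ i * ?p x) \<le> norm (B * \<bar>?p x\<bar>)" by simp
    qed (use fm \<psi>m in simp)
    have A1: "(\<integral>x. (\<Sum>k. a k * (f k x $ i * ?p x)) \<partial>lborel) = (\<Sum>k. \<integral>x. a k * (f k x $ i * ?p x) \<partial>lborel)"
    proof (rule integral_suminf)
      show "AE x in lborel. summable (\<lambda>k. norm (a k * (f k x $ i * ?p x)))"
      proof (rule AE_I2)
        fix x show "summable (\<lambda>k. norm (a k * (f k x $ i * ?p x)))"
          by (rule summable_comparison_test'[OF sa[of "B * \<bar>?p x\<bar>"], of 0]) (use b1 in simp)
      qed
      show "summable (\<lambda>k. \<integral>x. norm (a k * (f k x $ i * ?p x)) \<partial>lborel)"
      proof (rule summable_comparison_test'[OF sa[of "\<integral>x. B * \<bar>?p x\<bar> \<partial>lborel"], of 0])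
        fix k
        have "(\<integral>x. norm (a k * (f k x $ i * ?p x)) \<partial>lborel) \<le> (\<integral>x. a k * (B * \<bar>?p x\<bar>) \<partial>lborel)"
          by (rule integral_mono[OF integrable_norm[OF integrable_mult_right[OF int1k]] integrable_mult_right[OF int1] b1])
        then show "norm (\<integral>x. norm (a k * (f k x $ i * ?p x)) \<partial>lborel) \<le> a k * (\<integral>x. B * \<bar>?p x\<bar> \<partial>lborel)"
          by simp
      qed
    qed (use int1k in simp)
    have Fij: "\<bar>F k x $ i $ j\<bar> \<le> M k x" for k x
      using component_le_norm_cart[of "F k x $ i" j] Finite_Cartesian_Product.norm_nth_le[of "F k x" i] M(2)[of k x] by linarith
    have Fm: "(\<lambda>x. F k x $ i $ j) \<in> borel_measurable borel" for k
      using F[of k] by (intro borel_measurable_vec_component)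
    have b2: "norm (a k * (F k x $ i $ j * \<psi> x)) \<le> b * (a k * M k x)" for k x
    proof -
      have "\<bar>F k x $ i $ j\<bar> * \<bar>\<psi> x\<bar> \<le> M k x * b" using Fij[of k x] bR(2)[of x] M0 by (intro mult_mono) auto
      then have "a k * (\<bar>F k x $ i $ j\<bar> * \<bar>\<psi> x\<bar>) \<le> a k * (M k x * b)" using a(1)[of k] by (rule mult_left_mono)
      then show ?thesis using a(1)[of k] by (simp add: abs_mult mult_ac)
    qed
    have int2k: "integrable lborel (\<lambda>x. F k x $ i $ j * \<psi> x)" for k
    proof (rule Bochner_Integration.integrable_bound[OF integrable_mult_right[OF int_M[of k], of b]])
      show "(\<lambda>x. F k x $ i $ j * \<psi> x) \<in> borel_measurable lborel" using Fm \<psi>m by simp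
      have "norm (F k x $ i $ j * \<psi> x) \<le> norm (b * M k x)" for x
        using mult_mono[OF Fij[of k x] bR(2)[of x] M0] M0[of k x] bR(1) by (simp add: abs_mult mult.commute)
      then show "AE x in lborel. norm (F k x $ i $ j * \<psi> x) \<le> norm (b * M k x)" by simp
    qed
    have A2: "(\<integral>x. (\<Sum>k. a k * (F k x $ i $ j * \<psi> x)) \<partial>lborel) = (\<Sum>k. \<integral>x. a k * (F k x $ i $ j * \<psi> x) \<partial>lborel)"
    proof (rule integral_suminf)
      show "AE x in lborel. summable (\<lambda>k. norm (a k * (F k x $ i $ j * \<psi> x)))"
        using AE_sum
      proof eventually_elim
        case (elim x)
        show ?case by (rule summable_comparison_test'[OF summable_mult[OF elim, of b], of 0]) (use b2 in simp)
      qed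
      show "summable (\<lambda>k. \<integral>x. norm (a k * (F k x $ i $ j * \<psi> x)) \<partial>lborel)"
      proof (rule summable_comparison_test'[OF summable_mult[OF sa[of "max 0 C"], of b], of 0])
        fix k
        have "(\<integral>x. norm (a k * (F k x $ i $ j * \<psi> x)) \<partial>lborel) \<le> (\<integral>x. b * (a k * M k x) \<partial>lborel)"
          by (rule integral_mono[OF integrable_norm[OF integrable_mult_right[OF int2k]] integrable_mult_right[OF int_aM] b2])
        also have "\<dots> \<le> b * (a k * max 0 C)" using mult_left_mono[OF aM_C[of k] bR(1)] by simp
        finally show "norm (\<integral>x. norm (a k * (F k x $ i $ j * \<psi> x)) \<partial>lborel) \<le> b * (a k * max 0 C)"
          by simp
      qed
    qed (use int2k in simp)
    have ux: "u x $ i * ?p x = (\<Sum>k. a k * (f k x $ i * ?p x))" for x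
    proof -
      have "(\<lambda>k. (a k *\<^sub>R f k x) $ i) sums (u x $ i)"
        unfolding u_def by (rule bounded_linear.sums[OF bounded_linear_vec_nth summable_sums[OF sf]])
      then have "(\<lambda>k. (a k *\<^sub>R f k x) $ i * ?p x) sums (u x $ i * ?p x)" by (rule sums_mult2)
      then show ?thesis by (simp add: sums_iff mult.assoc)
    qed
    have Gx: "AE x in lborel. G x $ i $ j * \<psi> x = (\<Sum>k. a k * (F k x $ i $ j * \<psi> x))"
      using AE_sF
    proof eventually_elim
      case (elim x)
      have "(\<lambda>k. (a k *\<^sub>R F k x) $ i) sums (G x $ i)"
        unfolding G_def by (rule bounded_linear.sums[OF bounded_linear_vec_nth summable_sums[OF summable_norm_cancel[OF elim]]])
      then have "(\<lambda>k. (a k *\<^sub>R F k x) $ i $ j) sums (G x $ i $ j)"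
        by (rule bounded_linear.sums[OF bounded_linear_vec_nth])
      then have "(\<lambda>k. (a k *\<^sub>R F k x) $ i $ j * \<psi> x) sums (G x $ i $ j * \<psi> x)" by (rule sums_mult2)
      then show ?case by (simp add: sums_iff mult.assoc)
    qed
    have Gm: "(\<lambda>x. G x $ i $ j * \<psi> x) \<in> borel_measurable lborel"
      using \<psi>m by (intro borel_measurable_times borel_measurable_vec_component G_meas) simp
    have um: "(\<lambda>x. u x $ i * ?p x) \<in> borel_measurable lborel"
      using \<psi>m u_meas by (intro borel_measurable_times borel_measurable_vec_component) simp_all
    have "(\<integral>x. u x $ i * ?p x \<partial>lebesgue) = (\<integral>x. u x $ i * ?p x \<partial>lborel)"
      by (rule integral_completion[OF um])
    also have "\<dots> = (\<Sum>k. a k * (\<integral>x. f k x $ i * ?p x \<partial>lborel))" using A1 by (simp add: ux)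
    also have "\<dots> = (\<Sum>k. - (a k * (\<integral>x. F k x $ i $ j * \<psi> x \<partial>lborel)))" by (simp add: parts[OF \<psi>])
    also have "\<dots> = - (\<Sum>k. a k * (\<integral>x. F k x $ i $ j * \<psi> x \<partial>lborel))"
    proof (rule suminf_minus)
      have "summable (\<lambda>k. \<integral>x. a k * (F k x $ i $ j * \<psi> x) \<partial>lborel)"
      proof (rule summable_comparison_test'[OF summable_mult[OF sa[of "max 0 C"], of b], of 0])
        fix k
        have "norm (\<integral>x. a k * (F k x $ i $ j * \<psi> x) \<partial>lborel) \<le> (\<integral>x. norm (a k * (F k x $ i $ j * \<psi> x)) \<partial>lborel)"
          by (rule integral_norm_bound)
        also have "\<dots> \<le> (\<integral>x. b * (a k * M k x) \<partial>lborel)"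
          by (rule integral_mono[OF integrable_norm[OF integrable_mult_right[OF int2k]] integrable_mult_right[OF int_aM] b2])
        also have "\<dots> \<le> b * (a k * max 0 C)" using mult_left_mono[OF aM_C[of k] bR(1)] by simp
        finally show "norm (\<integral>x. a k * (F k x $ i $ j * \<psi> x) \<partial>lborel) \<le> b * (a k * max 0 C)" .
      qed
      then show "summable (\<lambda>k. a k * (\<integral>x. F k x $ i $ j * \<psi> x \<partial>lborel))" by simp
    qed
    also have "(\<Sum>k. a k * (\<integral>x. F k x $ i $ j * \<psi> x \<partial>lborel)) = (\<integral>x. (\<Sum>k. a k * (F k x $ i $ j * \<psi> x)) \<partial>lborel)"
      using A2 by simp
    also have "\<dots> = (\<integral>x. G x $ i $ j * \<psi> x \<partial>lborel)"
    proof (rule integral_cong_AE)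
      show "(\<lambda>x. \<Sum>k. a k * (F k x $ i $ j * \<psi> x)) \<in> borel_measurable lborel"
        using Fm \<psi>m by measurable
      show "AE x in lborel. (\<Sum>k. a k * (F k x $ i $ j * \<psi> x)) = G x $ i $ j * \<psi> x"
        using Gx by eventually_elim simp
    qed (rule Gm)
    also have "\<dots> = (\<integral>x. G x $ i $ j * \<psi> x \<partial>lebesgue)" by (rule integral_completion[symmetric, OF Gm])
    finally show ?thesis .
  qed
  have AE_G: "AE x in lborel. ennreal (A (norm (G x))) \<le> S x"
    using AE_sum AE_sF
  proof eventually_elim
    case (elim x)
    show ?case
    proof (cases "norm (G x) = 0")
      case True
      then show ?thesis using A by (simp add: young_function_def)
    next
      case False
      then have pos: "norm (G x) > 0" by simp
      let ?s = "\<lambda>K. \<Sum>k<K. a k *\<^sub>R F k x"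
      have "?s \<longlonglongrightarrow> G x" unfolding G_def by (rule summable_LIMSEQ[OF summable_norm_cancel[OF elim(2)]])
      then have lim: "(\<lambda>K. A (norm (?s K))) \<longlonglongrightarrow> A (norm (G x))"
        by (intro young_tendsto[OF A pos] tendsto_norm)
      \<comment> \<open>Jensen's inequality is applied to partial sums only; continuity of
        \<open>A\<close> at the positive number \<open>norm (G x)\<close> carries the bound over to
        the limit.\<close>
      have "A (norm (?s K)) \<le> (\<Sum>k. a k * M k x)" for K
      proof -
        have "norm (?s K) \<le> (\<Sum>k<K. a k * norm (F k x))"
          using norm_sum[of "\<lambda>k. a k *\<^sub>R F k x" "{..<K}"] a(1) by simp
        then have "A (norm (?s K)) \<le> A (\<Sum>k<K. a k * norm (F k x))" by (intro young_mono[OF A]) auto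
        also have "\<dots> \<le> (\<Sum>k<K. a k * A (norm (F k x)))"
        proof (rule young_sum[OF A a(1)])
          show "(\<Sum>k<K. a k) \<le> 1" using sum_le_suminf[OF a(2), of "{..<K}"] a(1,3) by simp
        qed simp
        also have "\<dots> \<le> (\<Sum>k<K. a k * M k x)" using a(1) M(3) by (intro sum_mono mult_left_mono) auto
        also have "\<dots> \<le> (\<Sum>k. a k * M k x)" using elim(1) aM0 by (intro sum_le_suminf) auto
        finally show ?thesis .
      qed
      then have "A (norm (G x)) \<le> (\<Sum>k. a k * M k x)" by (intro LIMSEQ_le_const2[OF lim]) auto
      then have "ennreal (A (norm (G x))) \<le> ennreal (\<Sum>k. a k * M k x)" by (rule ennreal_leI)
      also have "\<dots> = S x" unfolding S_def using aM0 elim(1) by (intro suminf_ennreal2[symmetric]) auto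
      finally show ?thesis .
    qed
  qed
  have orl: "in_orlicz A (\<lambda>x. norm (G x))"
    unfolding in_orlicz_def
  proof (intro conjI exI[of _ "max 1 C"])
    let ?l = "max 1 C"
    show "(\<lambda>x. norm (G x)) \<in> borel_measurable lebesgue"
      using borel_measurable_integrable[OF int_G'] by measurable
    show "?l > 0" by simp
    have "AE x in lebesgue. ennreal (A (\<bar>norm (G x)\<bar> / ?l)) \<le> ennreal (1 / ?l) * S x"
      using AE_completion[OF AE_G]
    proof eventually_elim
      case (elim x)
      have "A (1 / ?l * norm (G x)) \<le> 1 / ?l * A (norm (G x))" by (rule young_scale[OF A]) auto
      then have "ennreal (A (\<bar>norm (G x)\<bar> / ?l)) \<le> ennreal (1 / ?l * A (norm (G x)))"
        by (intro ennreal_leI) simp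
      also have "\<dots> = ennreal (1 / ?l) * ennreal (A (norm (G x)))" by (rule ennreal_mult') simp
      also have "\<dots> \<le> ennreal (1 / ?l) * S x" by (rule mult_left_mono[OF elim]) simp
      finally show ?case .
    qed
    then have "(\<integral>\<^sup>+x. ennreal (A (\<bar>norm (G x)\<bar> / ?l)) \<partial>lebesgue) \<le> (\<integral>\<^sup>+x. ennreal (1 / ?l) * S x \<partial>lebesgue)"
      by (rule nn_integral_mono_AE)
    also have "\<dots> = (\<integral>\<^sup>+x. ennreal (1 / ?l) * S x \<partial>lborel)" by (rule nn_integral_completion)
    also have "\<dots> = ennreal (1 / ?l) * (\<integral>\<^sup>+x. S x \<partial>lborel)" by (rule nn_integral_cmult) simp
    also have "\<dots> \<le> ennreal (1 / ?l) * ennreal ?l" by (rule mult_left_mono[OF int_S]) simp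
    also have "\<dots> = 1"
    proof -
      have "ennreal (1 / ?l) * ennreal ?l = ennreal (1 / ?l * ?l)" by (rule ennreal_mult'[symmetric]) simp
      also have "1 / ?l * ?l = 1" by simp
      finally show ?thesis by simp
    qed
    finally show "(\<integral>\<^sup>+x. ennreal (A (\<bar>norm (G x)\<bar> / ?l)) \<partial>lebesgue) \<le> 1" .
  qed
  have "weak_gradient u G" unfolding weak_gradient_def using loc_u loc_G weak by (intro conjI allI impI)
  then show "(\<lambda>x. \<Sum>k. a k *\<^sub>R f k x) \<in> V1A A"
    unfolding V1A_def u_def[symmetric] using orl by (intro CollectI exI[of _ G] conjI)
  show "continuous_on UNIV (\<lambda>x. \<Sum>k. a k *\<^sub>R f k x)" using cu unfolding u_def .
qed

section \<open>Energy of a family of cutoffs\<close>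

text \<open>A substitute for polar coordinates: \<open>y\<close> lies in one dyadic shell, whose
  term alone dominates the left side. Every summand has the same integral in dimension
  \<open>n\<close>, so the integral of the majorant grows linearly in the number of scales, hence in
  \<open>T\<close>.\<close>

lemma inverse_power_le_dyadic_sum:
  fixes y :: "'a::euclidean_space"
  assumes y: "norm y \<le> 1" "exp (- T) \<le> norm y" and I: "T / ln 2 \<le> real I"
  shows "(1 / norm y) ^ n \<le> (\<Sum>i\<le>I. 2 ^ (Suc i * n) * indicator (cball 0 ((1/2) ^ i)) y)"
proof -
  have pos: "norm y > 0" using y(2) exp_gt_zero[of "- T"] by linarith
  have ex: "\<exists>i. (1/2) ^ Suc i < norm y"
  proof -
    obtain k where k: "(1/2::real) ^ k < norm y" using real_arch_pow_inv[OF pos, of "1/2"] by auto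
    have "(1/2::real) ^ Suc k \<le> (1/2) ^ k" by (rule power_decreasing) auto
    then have "(1/2) ^ Suc k < norm y" using k by linarith
    then show ?thesis ..
  qed
  define i where "i = (LEAST i. (1/2) ^ Suc i < norm y)"
  have i: "(1/2) ^ Suc i < norm y" using LeastI_ex[OF ex] by (simp only: i_def)
  have yi: "norm y \<le> (1/2) ^ i"
  proof (cases i)
    case (Suc k)
    then have "k < (LEAST i. (1/2) ^ Suc i < norm y)" by (simp only: i_def)
    then have "\<not> (1/2) ^ Suc k < norm y" by (rule not_less_Least)
    then show ?thesis using Suc by simp
  qed (use y in simp)
  have "i \<le> I"
  proof -
    have "exp (- T) \<le> (1/2) ^ i" using y(2) yi by linarith
    then have "ln (exp (- T)) \<le> ln ((1/2) ^ i)" by (intro ln_mono) auto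
    then have "real i * ln 2 \<le> T" by (simp add: ln_realpow ln_div)
    then have "real i \<le> T / ln 2" by (simp add: pos_le_divide_eq)
    then show ?thesis using I by linarith
  qed
  have "1 / norm y \<le> 2 ^ Suc i"
  proof -
    have "1 / norm y \<le> 1 / (1/2) ^ Suc i" using i by (intro frac_le) auto
    then show ?thesis by (simp add: power_one_over)
  qed
  then have "(1 / norm y) ^ n \<le> (2 ^ Suc i) ^ n" by (intro power_mono) auto
  also have "\<dots> = 2 ^ (Suc i * n) * indicator (cball 0 ((1/2) ^ i)) y"
    using yi by (simp only: power_mult[symmetric]) (simp add: indicator_def)
  also have "\<dots> \<le> (\<Sum>i\<le>I. 2 ^ (Suc i * n) * indicator (cball 0 ((1/2) ^ i)) y)"
    using \<open>i \<le> I\<close> by (intro member_le_sum[of i "{..I}" "\<lambda>i. 2 ^ (Suc i * n) * indicator (cball 0 ((1/2) ^ i)) y"]) auto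
  finally show ?thesis .
qed

lemma nn_integral_dyadic_sum:
  fixes c :: "real^'n::finite"
  shows "(\<integral>\<^sup>+x. ennreal (\<Sum>i\<le>I. 2 ^ (Suc i * CARD('n)) * indicator (cball c ((1/2) ^ i)) x) \<partial>lborel)
    = ennreal ((real I + 1) * 2 ^ CARD('n) * unit_ball_vol CARD('n))"
proof -
  let ?n = "CARD('n)"
  have "(\<integral>\<^sup>+x. ennreal (\<Sum>i\<le>I. 2 ^ (Suc i * ?n) * indicator (cball c ((1/2) ^ i)) x) \<partial>lborel)
    = (\<integral>\<^sup>+x. (\<Sum>i\<le>I. ennreal (2 ^ (Suc i * ?n)) * indicator (cball c ((1/2) ^ i)) x) \<partial>lborel)"
  proof (rule nn_integral_cong)
    fix x
    have "(\<Sum>i\<le>I. ennreal (2 ^ (Suc i * ?n)) * indicator (cball c ((1/2) ^ i)) x)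
      = (\<Sum>i\<le>I. ennreal (2 ^ (Suc i * ?n) * indicator (cball c ((1/2) ^ i)) x))"
      by (intro sum.cong refl) (simp add: indicator_def)
    also have "\<dots> = ennreal (\<Sum>i\<le>I. 2 ^ (Suc i * ?n) * indicator (cball c ((1/2) ^ i)) x)"
      by (rule sum_ennreal) simp
    finally show "ennreal (\<Sum>i\<le>I. 2 ^ (Suc i * ?n) * indicator (cball c ((1/2) ^ i)) x)
      = (\<Sum>i\<le>I. ennreal (2 ^ (Suc i * ?n)) * indicator (cball c ((1/2) ^ i)) x)" ..
  qed
  also have "\<dots> = (\<Sum>i\<le>I. ennreal (2 ^ (Suc i * ?n)) * emeasure lborel (cball c ((1/2) ^ i)))"
  proof -
    have "(\<lambda>x. ennreal (2 ^ (Suc i * ?n)) * indicator (cball c ((1/2) ^ i)) x) \<in> borel_measurable lborel" for i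
      by (intro borel_measurable_times_ennreal borel_measurable_const borel_measurable_indicator) simp
    then show ?thesis
      by (subst nn_integral_sum) (simp_all only: nn_integral_cmult_indicator sets_lborel borel_closed closed_cball)
  qed
  also have "\<dots> = (\<Sum>i\<le>I. ennreal (2 ^ ?n * unit_ball_vol ?n))"
  proof (rule sum.cong[OF refl])
    fix i
    have "ennreal (2 ^ (Suc i * ?n)) * emeasure lborel (cball c ((1/2) ^ i))
      = ennreal (2 ^ (Suc i * ?n) * (unit_ball_vol ?n * ((1/2) ^ i) ^ ?n))"
      by (subst emeasure_cball) (simp_all add: ennreal_mult')
    also have "2 ^ (Suc i * ?n) * (unit_ball_vol ?n * ((1/2) ^ i) ^ ?n) = 2 ^ ?n * unit_ball_vol ?n"
    proof -
      have "(2::real) ^ (Suc i * ?n) * ((1/2) ^ i) ^ ?n = 2 ^ ?n"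
        by (simp add: power_add power_mult[symmetric] power_one_over)
      then show ?thesis by (metis mult.assoc mult.commute)
    qed
    finally show "ennreal (2 ^ (Suc i * ?n)) * emeasure lborel (cball c ((1/2) ^ i)) = ennreal (2 ^ ?n * unit_ball_vol ?n)" .
  qed
  also have "\<dots> = ennreal ((real I + 1) * 2 ^ ?n * unit_ball_vol ?n)"
    by (subst sum_ennreal) (simp_all add: algebra_simps)
  finally show ?thesis .
qed

lemma norm_outer_product:
  fixes a b :: "real^'n::finite"
  shows "norm (\<chi> i. (a $ i) *\<^sub>R b) = norm a * norm b"
  by (simp add: norm_vec_def[of "\<chi> i. (a $ i) *\<^sub>R b"] norm_vec_def[of a] L2_set_left_distrib)

text \<open>One level of the construction: around the centre \<open>c p\<close> the displacement is
  \<open>H *\<^sub>R v p\<close> up to radius \<open>exp (- (l + d))\<close> and fades out until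
  radius \<open>exp (- l)\<close>. By \<open>sep\<close> the open outer balls are disjoint, so at
  most one summand is nonzero at any point.\<close>

locale bump_family =
  fixes P :: "'p set" and c v :: "'p \<Rightarrow> real^'n::finite" and H l d :: real
  assumes fin: "finite P" and d: "d > 0" and l: "l > 0" and H: "H \<ge> 0"
    and v: "\<And>p. norm (v p) \<le> real CARD('n)"
    and sep: "\<And>p p'. p \<in> P \<Longrightarrow> p' \<in> P \<Longrightarrow> p \<noteq> p' \<Longrightarrow> 2 * exp (- l) \<le> dist (c p) (c p')"
begin

definition field :: "real^'n \<Rightarrow> real^'n" where
  "field x = H *\<^sub>R (\<Sum>p\<in>P. log_bump l d (x - c p) *\<^sub>R v p)"

text \<open>A sum of outer products; rows belong to components of the field and columns to
  directions of differentiation, as in \<open>weak_gradient\<close>.\<close>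

definition grad :: "real^'n \<Rightarrow> real^'n^'n" where
  "grad x = H *\<^sub>R (\<Sum>p\<in>P. \<chi> i. (v p $ i) *\<^sub>R log_bump_grad l d (x - c p))"

text \<open>By the triangle inequality every other centre is at distance at least
  \<open>exp (- l)\<close> from \<open>x\<close>. The summands are left polymorphic so that the
  vectors of \<open>field\<close> and the matrices of \<open>grad\<close> are covered alike.\<close>

lemma sum_single:
  fixes g :: "'p \<Rightarrow> 'b::comm_monoid_add"
  assumes "p0 \<in> P" "norm (x - c p0) \<le> exp (- l)"
    and "\<And>p. p \<in> P \<Longrightarrow> exp (- l) \<le> norm (x - c p) \<Longrightarrow> g p = 0"
  shows "sum g P = g p0"
proof -
  have "g p = 0" if "p \<in> P - {p0}" for p
  proof (rule assms(3))
    have "2 * exp (- l) \<le> dist (c p) (c p0)" using sep[of p p0] that assms(1) by auto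
    also have "\<dots> \<le> dist (c p) x + dist x (c p0)" by (rule dist_triangle)
    finally show "exp (- l) \<le> norm (x - c p)" using assms(2) by (simp add: dist_norm norm_minus_commute)
  qed (use that in auto)
  then have "sum g (P - {p0}) = 0" by (intro sum.neutral) auto
  then show ?thesis using sum.remove[OF fin assms(1), of g] by simp
qed

lemma sum_cases:
  fixes g :: "'p \<Rightarrow> 'b::comm_monoid_add"
  assumes "\<And>p. p \<in> P \<Longrightarrow> exp (- l) \<le> norm (x - c p) \<Longrightarrow> g p = 0"
  shows "sum g P = 0 \<or> (\<exists>p\<in>P. norm (x - c p) < exp (- l) \<and> sum g P = g p)"
proof (cases "\<exists>p\<in>P. norm (x - c p) < exp (- l)")
  case True
  then obtain p where p: "p \<in> P" "norm (x - c p) < exp (- l)" by blast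
  have "sum g P = g p" by (rule sum_single[OF p(1)]) (use p assms in auto)
  then show ?thesis using p by blast
next
  case False
  then have "sum g P = 0" by (intro sum.neutral ballI assms) (auto simp: not_less)
  then show ?thesis ..
qed

lemma field_eq:
  assumes "p \<in> P" "norm (x - c p) \<le> exp (- (l + d))"
  shows "field x = H *\<^sub>R v p"
proof -
  have "norm (x - c p) \<le> exp (- l)"
    by (rule order_trans[OF assms(2)]) (use d in simp)
  then have "(\<Sum>p\<in>P. log_bump l d (x - c p) *\<^sub>R v p) = log_bump l d (x - c p) *\<^sub>R v p"
    by (rule sum_single[OF assms(1)]) (simp add: log_bump_eq_0[OF d])
  then show ?thesis by (simp add: field_def log_bump_eq_1[OF d assms(2)])
qed

lemma norm_field_le: "norm (field x) \<le> H * real CARD('n)"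
proof -
  have "norm (\<Sum>p\<in>P. log_bump l d (x - c p) *\<^sub>R v p) \<le> real CARD('n)"
  proof -
    let ?g = "\<lambda>p. log_bump l d (x - c p) *\<^sub>R v p"
    have g: "norm (?g p) \<le> real CARD('n)" for p
    proof -
      have "\<bar>log_bump l d (x - c p)\<bar> * norm (v p) \<le> 1 * real CARD('n)"
        using log_bump_bounds[of l d "x - c p"] v[of p] by (intro mult_mono) auto
      then show ?thesis by simp
    qed
    have "sum ?g P = 0 \<or> (\<exists>p\<in>P. norm (x - c p) < exp (- l) \<and> sum ?g P = ?g p)"
      by (rule sum_cases) (simp add: log_bump_eq_0[OF d])
    then show ?thesis
    proof
      assume "sum ?g P = 0"
      then show ?thesis by simp
    next
      assume "\<exists>p\<in>P. norm (x - c p) < exp (- l) \<and> sum ?g P = ?g p"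
      then obtain p where "sum ?g P = ?g p" by blast
      then show ?thesis using g[of p] by (simp only:)
    qed
  qed
  then show ?thesis using H by (simp add: field_def mult_left_mono)
qed

lemma continuous_on_field: "continuous_on UNIV field"
proof -
  have "continuous_on UNIV (\<lambda>x. log_bump l d (x - c p))" for p
    by (rule continuous_on_compose2[OF continuous_on_log_bump[OF d]]) (auto intro!: continuous_intros)
  then show ?thesis unfolding field_def[abs_def] by (intro continuous_intros)
qed

lemma borel_measurable_outer:
  fixes g :: "real^'n \<Rightarrow> real^'n"
  assumes "g \<in> borel_measurable borel"
  shows "(\<lambda>x. \<chi> i. (a $ i) *\<^sub>R g x :: real^'n^'n) \<in> borel_measurable borel"
  by (rule measurable_compose[OF assms borel_measurable_continuous_onI]) (intro continuous_intros)

lemma borel_measurable_grad: "grad \<in> borel_measurable borel"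
proof -
  have "(\<lambda>x. log_bump_grad l d (x - c p)) \<in> borel_measurable borel" for p
    by (rule measurable_compose[OF _ borel_measurable_log_bump_grad]) simp
  then show ?thesis unfolding grad_def[abs_def]
    by (intro borel_measurable_scaleR borel_measurable_const borel_measurable_sum borel_measurable_outer)
qed

lemma grad_cases:
  "grad x = 0 \<or> (\<exists>p\<in>P. exp (- (l + d)) < norm (x - c p) \<and> norm (x - c p) < exp (- l) \<and>
     norm (grad x) \<le> (2 * H * real CARD('n) / d) / norm (x - c p))"
proof -
  let ?g = "\<lambda>p. (\<chi> i. (v p $ i) *\<^sub>R log_bump_grad l d (x - c p)) :: real^'n^'n"
  have g0: "?g p = 0" if "log_bump_grad l d (x - c p) = 0" for p
    unfolding that by (simp add: vec_eq_iff)
  have "sum ?g P = 0 \<or> (\<exists>p\<in>P. norm (x - c p) < exp (- l) \<and> sum ?g P = ?g p)"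
    by (rule sum_cases) (intro g0 log_bump_grad_eq_0[OF d] disjI1)
  then show ?thesis
  proof
    assume "sum ?g P = 0"
    then show ?thesis by (simp add: grad_def)
  next
    assume "\<exists>p\<in>P. norm (x - c p) < exp (- l) \<and> sum ?g P = ?g p"
    then obtain p where p: "p \<in> P" "norm (x - c p) < exp (- l)" "sum ?g P = ?g p" by blast
    show ?thesis
    proof (cases "norm (x - c p) \<le> exp (- (l + d))")
      case True
      then have "?g p = 0" by (intro g0 log_bump_grad_eq_0[OF d] disjI2)
      then show ?thesis using p(3) by (simp add: grad_def)
    next
      case False
      have "norm (grad x) = H * (norm (v p) * norm (log_bump_grad l d (x - c p)))"
        unfolding grad_def p(3) using H by (simp add: norm_outer_product)
      also have "\<dots> \<le> H * (real CARD('n) * (2 / d / norm (x - c p)))"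
        using H by (intro mult_left_mono mult_mono v norm_log_bump_grad_le[OF d]) auto
      also have "\<dots> = (2 * H * real CARD('n) / d) / norm (x - c p)" by simp
      finally show ?thesis using p False by (intro disjI2 bexI[of _ p]) auto
    qed
  qed
qed

lemma field_by_parts:
  assumes \<psi>: "test_function \<psi>"
  shows "(\<integral>x. field x $ i * partial_deriv j \<psi> x \<partial>lborel) = - (\<integral>x. grad x $ i $ j * \<psi> x \<partial>lborel)"
proof -
  let ?w = "\<lambda>p x. log_bump l d (x - c p)" and ?g = "\<lambda>p x. log_bump_grad l d (x - c p) $ j"
  have cw: "continuous_on UNIV (?w p)" for p
    by (rule continuous_on_compose2[OF continuous_on_log_bump[OF d]]) (auto intro!: continuous_intros)
  have der: "((\<lambda>t. ?w p (x + t *\<^sub>R axis j 1)) has_real_derivative ?g p x) (at 0)" for p x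
  proof -
    have "((\<lambda>x. x - c p) has_derivative (\<lambda>h. h)) (at x)" by (auto intro!: derivative_eq_intros)
    from has_derivative_compose[OF this has_derivative_log_bump[OF d]]
    have "(?w p has_derivative (\<lambda>h. log_bump_grad l d (x - c p) \<bullet> h)) (at x)" .
    from has_derivative_imp_directional[OF this, of "axis j 1"] show ?thesis by (simp add: inner_axis)
  qed
  have bw: "\<bar>?w p x\<bar> \<le> 1" for p x using log_bump_bounds[of l d "x - c p"] by simp
  have bg: "\<bar>?g p x\<bar> \<le> 2 / d * exp (l + d)" for p x
    using component_le_norm_cart norm_log_bump_grad_bound[OF d] by (rule order_trans)
  note parts = integral_by_parts_test_function[OF \<psi> cw bw bg der]
  have "(\<integral>x. field x $ i * partial_deriv j \<psi> x \<partial>lborel)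
      = (\<integral>x. (\<Sum>p\<in>P. H * v p $ i * (?w p x * partial_deriv j \<psi> x)) \<partial>lborel)"
    by (simp add: field_def sum_component sum_distrib_left sum_distrib_right mult_ac)
  also have "\<dots> = (\<Sum>p\<in>P. H * v p $ i * (\<integral>x. ?w p x * partial_deriv j \<psi> x \<partial>lborel))"
    using parts(1) by (subst Bochner_Integration.integral_sum) auto
  also have "\<dots> = (\<Sum>p\<in>P. - (H * v p $ i * (\<integral>x. ?g p x * \<psi> x \<partial>lborel)))"
    by (simp only: parts(3) mult_minus_right)
  also have "\<dots> = - (\<Sum>p\<in>P. H * v p $ i * (\<integral>x. ?g p x * \<psi> x \<partial>lborel))" by (rule sum_negf)
  also have "(\<Sum>p\<in>P. H * v p $ i * (\<integral>x. ?g p x * \<psi> x \<partial>lborel))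
      = (\<integral>x. (\<Sum>p\<in>P. H * v p $ i * (?g p x * \<psi> x)) \<partial>lborel)"
    using parts(2) by (subst Bochner_Integration.integral_sum) auto
  also have "\<dots> = (\<integral>x. grad x $ i $ j * \<psi> x \<partial>lborel)"
    by (simp add: grad_def sum_component sum_distrib_left sum_distrib_right mult_ac)
  finally show ?thesis .
qed

text \<open>The majorant is a multiple of the indicator of a large ball plus \<open>w\<close> times
  dyadic sums around the centres. Where the gradient is at most \<open>t1\<close> the ball pays;
  where it is larger, the growth of \<open>A\<close> at infinity gives
  \<open>\<theta> ^ n * (l + d) powr q / norm (x - c p) ^ n\<close>, which the dyadic sum dominates.
  The ball also bounds the support, so small gradients cost a finite amount.\<close>

lemma grad_majorant:
  fixes A :: "real \<Rightarrow> real"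
  defines "n \<equiv> CARD('n)"
  defines "\<theta> \<equiv> 2 * H * real CARD('n) / d"
  assumes A: "young_function A"
    and t1: "t1 \<ge> 1" "CA \<ge> 0" "\<And>t. t > t1 \<Longrightarrow> A t \<le> CA * (t ^ n * ln t powr q)" and q: "q \<ge> 0"
    and t2: "t2 > 0" "A t2 > 0"
    and \<theta>: "\<theta> \<le> 1"
    and R: "R \<ge> 0" "\<And>p. p \<in> P \<Longrightarrow> norm (c p) \<le> R"
    and W: "real (card P) * (\<theta> ^ n * (l + d) powr q * ((l + d) / ln 2 + 2)) \<le> W"
  shows "\<exists>M. M \<in> borel_measurable borel \<and> (\<forall>x. norm (grad x) \<le> M x \<and> A (norm (grad x)) \<le> M x) \<and>
    (\<integral>\<^sup>+x. ennreal (M x) \<partial>lborel) \<le>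
      ennreal ((A t1 + CA + t2 + t2 / A t2 * (A t1 + CA)) * (unit_ball_vol n * (R + 1) ^ n + 2 ^ n * unit_ball_vol n * W))"
proof -
  define w where "w = \<theta> ^ n * (l + d) powr q"
  define I where "I = nat \<lceil>(l + d) / ln 2\<rceil>"
  define c1 where "c1 = A t1 + CA"
  define J where "J p x = (\<Sum>i\<le>I. 2 ^ (Suc i * n) * indicator (cball (c p) ((1/2) ^ i)) x :: real)" for p x
  define N where "N x = indicator (cball 0 (R + 1)) x + w * (\<Sum>p\<in>P. J p x)" for x :: "real^'n"
  have \<theta>0: "\<theta> \<ge> 0" using H d by (simp add: \<theta>_def)
  have w0: "w \<ge> 0" using \<theta>0 by (simp add: w_def)
  have ld: "(l + d) / ln 2 \<ge> 0" using l d by simp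
  have I1: "(l + d) / ln 2 \<le> real I" unfolding I_def by (rule real_nat_ceiling_ge)
  \<comment> \<open>There are \<open>I + 1\<close> dyadic scales, and rounding up costs at most one
    more: this is the \<open>+ 2\<close> in the hypothesis on \<open>W\<close>.\<close>
  have I2: "real I + 1 \<le> (l + d) / ln 2 + 2" using ld unfolding I_def by linarith
  have J0: "J p x \<ge> 0" for p x unfolding J_def by (intro sum_nonneg) simp
  have N0: "w * (\<Sum>p\<in>P. J p x) \<ge> 0" for x using w0 J0 by (intro mult_nonneg_nonneg sum_nonneg)
  have At1: "A t1 \<ge> 0" using t1 by (intro young_nonneg[OF A]) simp
  have c10: "c1 \<ge> 0" using At1 t1 by (simp add: c1_def)
  have inR: "1 \<le> N x" if "p \<in> P" "norm (x - c p) < exp (- l)" for p x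
  proof -
    have "exp (- l) \<le> 1" using l by simp
    then have "norm x \<le> R + 1" using that R(2)[OF that(1)] norm_triangle_sub[of x "c p"] by linarith
    then show ?thesis using N0[of x] by (simp add: N_def)
  qed
  have N00: "N x \<ge> 0" for x using N0[of x] by (simp add: N_def)
  have claim1: "A (norm (grad x)) \<le> c1 * N x" for x
  proof (cases "grad x = 0")
    case True
    then have "A (norm (grad x)) = 0" using A by (simp add: young_function_def)
    then show ?thesis using c10 N00[of x] by simp
  next
    case False
    then obtain p where p: "p \<in> P" "exp (- (l + d)) < norm (x - c p)" "norm (x - c p) < exp (- l)"
      "norm (grad x) \<le> \<theta> / norm (x - c p)"
      using grad_cases[of x] unfolding \<theta>_def by blast
    let ?y = "x - c p"
    have ypos: "norm ?y > 0" using p(2) exp_gt_zero[of "- (l + d)"] by linarith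
    have y1: "norm ?y \<le> 1"
    proof -
      have "exp (- l) \<le> 1" using l by simp
      then show ?thesis using p(3) by linarith
    qed
    show ?thesis
    proof (cases "norm (grad x) \<le> t1")
      case True
      then have "A (norm (grad x)) \<le> A t1" by (intro young_mono[OF A]) auto
      also have "\<dots> \<le> c1 * 1" using t1 by (simp add: c1_def)
      also have "\<dots> \<le> c1 * N x" using c10 inR[OF p(1,3)] by (intro mult_left_mono)
      finally show ?thesis .
    next
      case False
      define s where "s = \<theta> / norm ?y"
      have s: "s > t1" "norm (grad x) \<le> s" using False p(4) by (auto simp: s_def)
      \<comment> \<open>Here \<open>\<theta> \<le> 1\<close> enters: it gives
        \<open>s \<le> 1 / norm ?y\<close>, and on the annulus the logarithm of the latter is below
        \<open>l + d\<close>.\<close>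
      have "ln s \<le> l + d"
      proof -
        have "s \<le> 1 / norm ?y" unfolding s_def using \<theta> ypos by (intro divide_right_mono) auto
        then have "ln s \<le> ln (1 / norm ?y)" using s t1 by (intro ln_mono) auto
        also have "\<dots> = - ln (norm ?y)" using ypos by (simp add: ln_div)
        also have "\<dots> \<le> l + d"
          using ypos p(2) ln_mono[of "exp (- (l + d))" "norm ?y"] by simp
        finally show ?thesis .
      qed
      moreover have "0 \<le> ln s" using s t1 by simp
      ultimately have L: "ln s powr q \<le> (l + d) powr q" using q by (intro powr_mono2)
      have "exp (- (l + d)) \<le> norm ?y" using p(2) by simp
      from inverse_power_le_dyadic_sum[OF y1 this I1, of n]
      have "(1 / norm ?y) ^ n \<le> (\<Sum>i\<le>I. 2 ^ (Suc i * n) * indicator (cball 0 ((1/2) ^ i)) ?y)" .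
      also have "\<dots> = J p x" unfolding J_def
        by (intro sum.cong refl) (simp add: indicator_def dist_norm norm_minus_commute)
      finally have D: "(1 / norm ?y) ^ n \<le> J p x" .
      have "A (norm (grad x)) \<le> A s" using s by (intro young_mono[OF A]) auto
      also have "\<dots> \<le> CA * (s ^ n * ln s powr q)" by (rule t1(3)[OF s(1)])
      also have "s ^ n = \<theta> ^ n * (1 / norm ?y) ^ n" by (simp add: s_def power_divide)
      also have "CA * (\<theta> ^ n * (1 / norm ?y) ^ n * ln s powr q) \<le> CA * (\<theta> ^ n * J p x * (l + d) powr q)"
        using t1(2) \<theta>0 D L J0 by (intro mult_left_mono mult_mono) auto
      also have "\<dots> = CA * (w * J p x)" by (simp add: w_def mult_ac)
      also have "\<dots> \<le> CA * (w * (\<Sum>p\<in>P. J p x))"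
        using t1(2) w0 J0 by (intro mult_left_mono member_le_sum[OF p(1)] fin) auto
      also have "\<dots> \<le> c1 * (w * (\<Sum>p\<in>P. J p x))" using At1 N0 by (intro mult_right_mono) (auto simp: c1_def)
      also have "\<dots> \<le> c1 * N x" using c10 by (intro mult_left_mono) (auto simp: N_def)
      finally show ?thesis .
    qed
  qed
  \<comment> \<open>Convexity and \<open>A 0 = 0\<close> force at least linear growth of
    \<open>A\<close> beyond \<open>t2\<close>, so the bound for \<open>A (norm (grad x))\<close>
    implies one for \<open>norm (grad x)\<close>; up to \<open>t2\<close> the ball indicator
    suffices.\<close>
  have claim2: "norm (grad x) \<le> (t2 + t2 / A t2 * c1) * N x" for x
  proof (cases "grad x = 0")
    case True
    then show ?thesis using t2 c10 N00[of x] by simp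
  next
    case False
    then obtain p where p: "p \<in> P" "norm (x - c p) < exp (- l)" using grad_cases[of x] by blast
    show ?thesis
    proof (cases "norm (grad x) \<le> t2")
      case True
      also have "t2 * 1 \<le> t2 * N x" using t2 inR[OF p] by (intro mult_left_mono) auto
      moreover have "0 \<le> t2 / A t2 * c1 * N x" using t2 c10 N00[of x] by simp
      ultimately show ?thesis using True by (simp add: distrib_right)
    next
      case False
      define T where "T = norm (grad x)"
      have T: "T > t2" "T > 0" using False t2 by (auto simp: T_def)
      have "A (t2 / T * T) \<le> t2 / T * A T" using T t2 by (intro young_scale[OF A]) auto
      then have "A t2 \<le> t2 * A T / T" using T by simp
      then have "A t2 * T \<le> t2 * A T" using T by (simp add: pos_le_divide_eq)
      then have "T \<le> t2 / A t2 * A T" using t2 by (simp add: pos_le_divide_eq mult.commute)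
      also have "\<dots> \<le> t2 / A t2 * (c1 * N x)" using t2 claim1[of x] by (intro mult_left_mono) (auto simp: T_def)
      also have "\<dots> \<le> (t2 + t2 / A t2 * c1) * N x"
        using mult_nonneg_nonneg[OF less_imp_le[OF t2(1)] N00[of x]] by (simp add: distrib_right mult.assoc)
      finally show ?thesis by (simp add: T_def)
    qed
  qed
  define C0 where "C0 = c1 + t2 + t2 / A t2 * c1"
  have k0: "0 \<le> t2 / A t2 * c1" using t2 c10 by simp
  have C0: "C0 \<ge> 0" "c1 \<le> C0" "t2 + t2 / A t2 * c1 \<le> C0" using k0 c10 t2 by (auto simp: C0_def)
  have Jm: "(\<lambda>x. J p x) \<in> borel_measurable borel" for p
    unfolding J_def by (intro borel_measurable_sum borel_measurable_times borel_measurable_const borel_measurable_indicator) simp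
  have Nm: "N \<in> borel_measurable borel"
    unfolding N_def by (intro borel_measurable_add borel_measurable_sum borel_measurable_times borel_measurable_const borel_measurable_indicator Jm) simp
  have intN: "(\<integral>\<^sup>+x. ennreal (N x) \<partial>lborel) \<le> ennreal (unit_ball_vol n * (R + 1) ^ n + 2 ^ n * unit_ball_vol n * W)"
  proof -
    have "(\<integral>\<^sup>+x. ennreal (N x) \<partial>lborel) = (\<integral>\<^sup>+x. indicator (cball 0 (R + 1)) x + ennreal w * (\<Sum>p\<in>P. ennreal (J p x)) \<partial>lborel)"
    proof (rule nn_integral_cong)
      fix x
      have "ennreal (N x) = ennreal (indicator (cball 0 (R + 1)) x) + ennreal (w * (\<Sum>p\<in>P. J p x))"
        unfolding N_def by (rule ennreal_plus) (use N0 in auto)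
      also have "ennreal (w * (\<Sum>p\<in>P. J p x)) = ennreal w * ennreal (\<Sum>p\<in>P. J p x)" by (rule ennreal_mult'[OF w0])
      also have "ennreal (\<Sum>p\<in>P. J p x) = (\<Sum>p\<in>P. ennreal (J p x))" by (rule sum_ennreal[symmetric]) (rule J0)
      also have "ennreal (indicator (cball 0 (R + 1)) x) = indicator (cball 0 (R + 1)) x" by (rule ennreal_indicator)
      finally show "ennreal (N x) = indicator (cball 0 (R + 1)) x + ennreal w * (\<Sum>p\<in>P. ennreal (J p x))" .
    qed
    also have "\<dots> = (\<integral>\<^sup>+x. indicator (cball (0::real^'n) (R + 1)) x \<partial>lborel) + (\<integral>\<^sup>+x. ennreal w * (\<Sum>p\<in>P. ennreal (J p x)) \<partial>lborel)"
    proof (rule nn_integral_add)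
      show "(\<lambda>x. ennreal w * (\<Sum>p\<in>P. ennreal (J p x))) \<in> borel_measurable lborel"
        using Jm by (intro borel_measurable_times_ennreal borel_measurable_const borel_measurable_sum measurable_compose[OF _ measurable_ennreal]) simp
    qed (rule borel_measurable_indicator, simp)
    also have "(\<integral>\<^sup>+x. ennreal w * (\<Sum>p\<in>P. ennreal (J p x)) \<partial>lborel) = ennreal w * (\<integral>\<^sup>+x. (\<Sum>p\<in>P. ennreal (J p x)) \<partial>lborel)"
      using Jm by (intro nn_integral_cmult borel_measurable_sum measurable_compose[OF _ measurable_ennreal]) auto
    also have "(\<integral>\<^sup>+x. (\<Sum>p\<in>P. ennreal (J p x)) \<partial>lborel) = (\<Sum>p\<in>P. \<integral>\<^sup>+x. ennreal (J p x) \<partial>lborel)"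
      using Jm by (intro nn_integral_sum measurable_compose[OF _ measurable_ennreal]) auto
    also have "\<dots> = (\<Sum>p\<in>P. ennreal ((real I + 1) * 2 ^ n * unit_ball_vol n))"
      unfolding J_def n_def by (simp only: nn_integral_dyadic_sum)
    also have "\<dots> = ennreal (real (card P) * ((real I + 1) * 2 ^ n * unit_ball_vol n))"
      by (subst sum_ennreal) (simp_all add: n_def)
    also have "ennreal w * \<dots> = ennreal (w * (real (card P) * ((real I + 1) * 2 ^ n * unit_ball_vol n)))"
      by (rule ennreal_mult'[symmetric, OF w0])
    also have "\<dots> \<le> ennreal (2 ^ n * unit_ball_vol n * W)"
    proof (rule ennreal_leI)
      have "real (card P) * (w * (real I + 1)) \<le> real (card P) * (w * ((l + d) / ln 2 + 2))"
        using I2 w0 by (intro mult_left_mono) auto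
      also have "\<dots> \<le> W" using W by (simp only: w_def)
      finally have "2 ^ n * unit_ball_vol n * (real (card P) * (w * (real I + 1))) \<le> 2 ^ n * unit_ball_vol n * W"
        by (intro mult_left_mono) (auto simp: n_def)
      then show "w * (real (card P) * ((real I + 1) * 2 ^ n * unit_ball_vol n)) \<le> 2 ^ n * unit_ball_vol n * W"
        by (simp only: mult_ac)
    qed
    also have "(\<integral>\<^sup>+x. indicator (cball (0::real^'n) (R + 1)) x \<partial>lborel) = ennreal (unit_ball_vol n * (R + 1) ^ n)"
      using R(1) by (simp add: emeasure_cball n_def)
    finally have *: "(\<integral>\<^sup>+x. ennreal (N x) \<partial>lborel) \<le> ennreal (unit_ball_vol n * (R + 1) ^ n) + ennreal (2 ^ n * unit_ball_vol n * W)"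
      by (simp add: add_left_mono)
    have "0 \<le> W" using W \<theta>0 ld by (intro order_trans[OF _ W] mult_nonneg_nonneg) auto
    then show ?thesis using * R(1) by (subst ennreal_plus) (auto simp: n_def)
  qed
  have M1: "norm (grad x) \<le> C0 * N x" for x
    by (rule order_trans[OF claim2 mult_right_mono[OF C0(3) N00]])
  have M2: "A (norm (grad x)) \<le> C0 * N x" for x
    by (rule order_trans[OF claim1 mult_right_mono[OF C0(2) N00]])
  have M3: "(\<integral>\<^sup>+x. ennreal (C0 * N x) \<partial>lborel) \<le> ennreal (C0 * (unit_ball_vol n * (R + 1) ^ n + 2 ^ n * unit_ball_vol n * W))"
  proof -
    have "(\<integral>\<^sup>+x. ennreal (C0 * N x) \<partial>lborel) = (\<integral>\<^sup>+x. ennreal C0 * ennreal (N x) \<partial>lborel)"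
      by (simp only: ennreal_mult'[OF C0(1)])
    also have "\<dots> = ennreal C0 * (\<integral>\<^sup>+x. ennreal (N x) \<partial>lborel)"
      using Nm by (intro nn_integral_cmult measurable_compose[OF _ measurable_ennreal]) simp
    also have "\<dots> \<le> ennreal C0 * ennreal (unit_ball_vol n * (R + 1) ^ n + 2 ^ n * unit_ball_vol n * W)"
      by (rule mult_left_mono[OF intN]) simp
    also have "\<dots> = ennreal (C0 * (unit_ball_vol n * (R + 1) ^ n + 2 ^ n * unit_ball_vol n * W))"
      by (rule ennreal_mult'[symmetric, OF C0(1)])
    finally show ?thesis .
  qed
  show ?thesis
  proof (intro exI[of _ "\<lambda>x. C0 * N x"] conjI allI M1 M2)
    show "(\<lambda>x. C0 * N x) \<in> borel_measurable borel" using Nm by (intro borel_measurable_times borel_measurable_const)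
    show "(\<integral>\<^sup>+x. ennreal (C0 * N x) \<partial>lborel) \<le>
      ennreal ((A t1 + CA + t2 + t2 / A t2 * (A t1 + CA)) * (unit_ball_vol n * (R + 1) ^ n + 2 ^ n * unit_ball_vol n * W))"
      using M3 unfolding C0_def c1_def .
  qed
qed

end

section \<open>The construction\<close>

lemma one_le_CARD: "1 \<le> real CARD('n::finite)"
  using zero_less_card_finite[where 'a='n] by linarith

lemma power_powr: "0 < x \<Longrightarrow> (x ^ k) powr a = (x powr a) ^ k" for x a :: real
  by (simp add: powr_realpow[symmetric] powr_powr mult.commute)

text \<open>A constant factor in front of \<open>r k\<close> changes
  \<open>ln (1 / r k) = L * \<tau> ^ k\<close> only by a bounded summand, which amounts to replacing
  \<open>L\<close> by another constant \<open>a\<close>. Since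
  \<open>(a * \<tau> ^ k) powr \<beta> * m ^ k\<close> equals \<open>a powr \<beta>\<close> for all
  \<open>k\<close>, both coding criteria apply with bounds independent of \<open>k\<close>.\<close>

lemma hausdorff_gauge_log_cantor:
  fixes \<phi> :: "real \<Rightarrow> real" and \<beta> L \<tau> :: real and r :: "nat \<Rightarrow> real"
  assumes \<phi>: "gauge_function \<phi>" and \<beta>: "\<beta> < 0" and eq: "equiv_near_zero \<phi> (\<lambda>r. ln (1 / r) powr \<beta>)"
    and L: "L \<ge> 4 * real CARD('n::finite)" and \<tau>: "\<tau> > 1" "\<tau> powr \<beta> = 1 / 2 ^ CARD('n)"
    and r: "\<And>k. r k = exp (- (L * \<tau> ^ k))" and dw: "decaying_weights r (1/4)"
  shows "0 < hausdorff_gauge \<phi> (range (code_point r :: _ \<Rightarrow> real^'n))"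
    and "hausdorff_gauge \<phi> (range (code_point r :: _ \<Rightarrow> real^'n)) < \<infinity>"
proof -
  interpret D: decaying_weights r "1/4" by (rule dw)
  let ?n = "CARD('n)"
  define m where "m = (2::real) ^ ?n"
  have mb: "real CARD(bool^'n) = m" unfolding m_def card_bool_vec by simp
  have m: "m \<ge> 2" using power_increasing[of 1 ?n "2::real"] zero_less_card_finite[where 'a='n] by (simp add: m_def)
  have n1: "1 \<le> real ?n" by (rule one_le_CARD)
  have gap: "D.gap = 2/3" by (simp add: D.gap_def)
  obtain c r0 where c: "c > 0" "r0 > 0" "\<And>s. 0 < s \<Longrightarrow> s < r0 \<Longrightarrow> ln (1 / s) powr \<beta> / c \<le> \<phi> s"
    "\<And>s. 0 < s \<Longrightarrow> s < r0 \<Longrightarrow> \<phi> s \<le> c * ln (1 / s) powr \<beta>"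
    using eq unfolding equiv_near_zero_def by (auto simp: greaterThanLessThan_iff)
  have \<tau>k: "1 \<le> \<tau> ^ k" for k using \<tau>(1) by (intro one_le_power) simp
  have L4: "L \<ge> 4" using L n1 by linarith
  have scale: "(a * \<tau> ^ k) powr \<beta> * m ^ k = a powr \<beta>" if "a > 0" for a k
  proof -
    have "(a * \<tau> ^ k) powr \<beta> = a powr \<beta> * (\<tau> powr \<beta>) ^ k"
      using that \<tau>(1) by (subst powr_mult) (simp_all add: power_powr)
    also have "\<dots> * m ^ k = a powr \<beta> * (\<tau> powr \<beta> * m) ^ k" by (simp add: power_mult_distrib)
    also have "\<tau> powr \<beta> * m = 1" unfolding \<tau>(2) m_def by simp
    finally show ?thesis by simp
  qed
  have small: "\<exists>k0. \<forall>k\<ge>k0. a * r k < r0" for a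
  proof -
    have "(\<lambda>k. a * r k) \<longlonglongrightarrow> a * 0" by (intro tendsto_intros D.s_tendsto_0)
    then have "\<forall>\<^sub>F k in sequentially. a * r k < r0" using c(2) by (intro order_tendstoD(2)) auto
    then show ?thesis unfolding eventually_sequentially .
  qed
  obtain k0 where k0: "\<And>k. k \<ge> k0 \<Longrightarrow> 2/3 * r k < r0" using small[of "2/3"] by blast
  \<comment> \<open>The factor 2/3 adds \<open>ln (3/2) \<le> 1 \<le> \<tau> ^ k\<close> to the
    logarithm, so \<open>L + 1\<close> replaces \<open>L\<close>; a negative exponent \<beta> turns
    this upper bound into a lower one.\<close>
  have "ennreal ((L + 1) powr \<beta> / c) \<le> hausdorff_gauge \<phi> (range (code_point r :: _ \<Rightarrow> real^'n))"
  proof (rule hausdorff_gauge_ge_coded[OF \<phi>, where s = "\<lambda>k. D.gap * r k" and ?k0.0 = k0])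
    show "0 < D.gap * r k" for k using D.s_pos D.gap_pos by simp
    show "(\<lambda>k. D.gap * r k) \<longlonglongrightarrow> 0" by (rule tendsto_mult_right_zero[OF D.s_tendsto_0])
    show "\<forall>j\<le>k. e j = e' j" if "dist (code_point r e) (code_point r e') < D.gap * r k" for e e' :: "nat \<Rightarrow> bool^'n" and k
      by (rule D.code_point_separated[OF that])
    show "2 \<le> CARD(bool^'n)" using m mb by linarith
    show "0 < (L + 1) powr \<beta> / c" using c L4 by simp
    fix k assume "k0 \<le> k"
    then have s: "0 < 2/3 * r k" "2/3 * r k < r0" using k0 D.s_pos[of k] by auto
    have e: "ln (1 / (2/3 * r k)) = ln (3/2) + L * \<tau> ^ k" unfolding r by (simp add: ln_div ln_mult)
    have l1: "ln (3/2::real) \<le> 1" using ln_le_minus_one[of "3/2::real"] by simp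
    have l2: "ln (3/2::real) > 0" by simp
    have l3: "L * \<tau> ^ k > 0" using L4 \<tau>(1) by simp
    have *: "0 < ln (1 / (2/3 * r k))" "ln (1 / (2/3 * r k)) \<le> (L + 1) * \<tau> ^ k"
      unfolding e distrib_right using l1 l2 l3 \<tau>k[of k] by linarith+
    have "(L + 1) powr \<beta> / c = ((L + 1) * \<tau> ^ k) powr \<beta> / c * m ^ k" using scale[of "L + 1" k] L4 by simp
    also have "\<dots> \<le> ln (1 / (2/3 * r k)) powr \<beta> / c * m ^ k"
      using * \<beta> c m by (intro mult_right_mono divide_right_mono powr_mono2') auto
    also have "\<dots> \<le> \<phi> (2/3 * r k) * m ^ k" using c(3)[OF s] m by (intro mult_right_mono) auto
    finally show "(L + 1) powr \<beta> / c \<le> \<phi> (D.gap * r k) * real CARD(bool^'n) ^ k" unfolding gap mb .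
  qed
  moreover have "0 < ennreal ((L + 1) powr \<beta> / c)" using c L4 by simp
  ultimately show "0 < hausdorff_gauge \<phi> (range (code_point r :: _ \<Rightarrow> real^'n))" by (rule less_le_trans[rotated])
  obtain k1 where k1: "\<And>k. k \<ge> k1 \<Longrightarrow> 2 * real ?n * r k < r0" using small[of "2 * real ?n"] by blast
  have "hausdorff_gauge \<phi> (range (code_point r :: _ \<Rightarrow> real^'n)) \<le> ennreal (c * (L / 2) powr \<beta>)"
  proof (rule hausdorff_gauge_le_coded[OF \<phi>, where t = "\<lambda>k. 2 * real ?n * r k" and ?k0.0 = k1])
    show "0 \<le> 2 * real ?n * r k" for k using D.s_pos[of k] by simp
    show "(\<lambda>k. 2 * real ?n * r k) \<longlonglongrightarrow> 0" by (rule tendsto_mult_right_zero[OF D.s_tendsto_0])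
    show "dist (code_point r e) (code_point r e') \<le> 2 * real ?n * r k"
      if "\<And>j. j < k \<Longrightarrow> e j = e' j" for e e' :: "nat \<Rightarrow> bool^'n" and k
      by (rule D.dist_code_point_le[OF that])
    fix k assume "k1 \<le> k"
    then have s: "0 < 2 * real ?n * r k" "2 * real ?n * r k < r0" using k1 D.s_pos[of k] n1 by auto
    have e: "ln (1 / (2 * real ?n * r k)) = L * \<tau> ^ k - ln (2 * real ?n)"
      unfolding r using n1 by (simp add: ln_div ln_mult)
    \<comment> \<open>This is what \<open>L \<ge> 4 * n\<close> is for: the factor
      \<open>2 * n\<close> takes away at most half of the logarithm.\<close>
    have "ln (2 * real ?n) \<le> 2 * real ?n - 1" using n1 by (intro ln_le_minus_one) auto
    then have "ln (2 * real ?n) \<le> L / 2" using L by linarith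
    also have "L / 2 \<le> L / 2 * \<tau> ^ k" using mult_left_mono[OF \<tau>k[of k], of "L / 2"] L4 by simp
    finally have *: "L / 2 * \<tau> ^ k \<le> ln (1 / (2 * real ?n * r k))" unfolding e by linarith
    have "\<phi> (2 * real ?n * r k) \<le> c * ln (1 / (2 * real ?n * r k)) powr \<beta>" by (rule c(4)[OF s])
    also have "\<dots> \<le> c * (L / 2 * \<tau> ^ k) powr \<beta>"
      using * \<beta> c L4 \<tau>(1) by (intro mult_left_mono powr_mono2') auto
    finally have "\<phi> (2 * real ?n * r k) * m ^ k \<le> c * (L / 2 * \<tau> ^ k) powr \<beta> * m ^ k"
      using m by (intro mult_right_mono) auto
    also have "\<dots> = c * (L / 2) powr \<beta>" using scale[of "L / 2" k] L4 by (simp add: mult.assoc)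
    finally show "\<phi> (2 * real ?n * r k) * real CARD(bool^'n) ^ k \<le> c * (L / 2) powr \<beta>" unfolding mb .
  qed
  then show "hausdorff_gauge \<phi> (range (code_point r :: _ \<Rightarrow> real^'n)) < \<infinity>" by (rule le_less_trans) simp
qed

text \<open>In \<open>m ^ k * \<Phi> (gap * h k)\<close> the factor
  \<open>(h0 ^ k) powr \<sigma>\<close> cancels \<open>m ^ k\<close>, the weights leave
  \<open>real (Suc k) powr (- (\<sigma> + 1))\<close> and the logarithm contributes
  \<open>real (Suc k) powr \<mu>\<close>. The total exponent \<open>\<mu> - \<sigma> - 1\<close> is
  positive, so starting at a late level yields any lower bound \<open>K\<close>.\<close>

lemma hausdorff_gauge_power_log_cantor:
  fixes \<Phi> :: "real \<Rightarrow> real" and \<sigma> \<mu> Z h0 :: real and h :: "nat \<Rightarrow> real"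
  assumes \<Phi>: "gauge_function \<Phi>" and \<sigma>: "\<sigma> > 0" and \<mu>: "\<mu> > 1 + \<sigma>"
    and eq: "equiv_near_zero \<Phi> (\<lambda>r. r powr \<sigma> * ln (1 / r) powr \<mu>)"
    and Z: "Z \<ge> 1" and h0: "h0 > 0" "h0 powr \<sigma> = 1 / 2 ^ CARD('n::finite)"
    and h: "\<And>k. h k = real (Suc k) powr (- (1 + 1 / \<sigma>)) / Z * h0 ^ k" and dw: "decaying_weights h h0"
  shows "hausdorff_gauge \<Phi> (range (code_point h :: _ \<Rightarrow> real^'n)) = \<infinity>"
proof -
  interpret D: decaying_weights h h0 by (rule dw)
  let ?n = "CARD('n)"
  define m where "m = (2::real) ^ ?n"
  have mb: "real CARD(bool^'n) = m" unfolding m_def card_bool_vec by simp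
  have m: "m \<ge> 2" using power_increasing[of 1 ?n "2::real"] zero_less_card_finite[where 'a='n] by (simp add: m_def)
  obtain c r0 where c: "c > 0" "r0 > 0" "\<And>s. 0 < s \<Longrightarrow> s < r0 \<Longrightarrow> s powr \<sigma> * ln (1 / s) powr \<mu> / c \<le> \<Phi> s"
    using eq unfolding equiv_near_zero_def by (auto simp: greaterThanLessThan_iff)
  have g1: "D.gap \<le> 1"
    unfolding D.gap_def using D.x by (subst divide_le_eq_1_pos) auto
  define \<eta> where "\<eta> = ln (1 / h0)"
  have \<eta>: "\<eta> > 0" using D.x by (simp add: \<eta>_def ln_div)
  define C where "C = (D.gap / Z) powr \<sigma> * (\<eta> / 2) powr \<mu> / c"
  have C: "C > 0" using D.gap_pos Z \<eta> c by (simp add: C_def)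
  have bound: "C * real (Suc k) powr (\<mu> - \<sigma> - 1) \<le> \<Phi> (D.gap * h k) * m ^ k" if k: "k \<ge> 1" "D.gap * h k < r0" for k
  proof -
    define s where "s = D.gap * h k"
    have s0: "s > 0" using D.gap_pos D.s_pos by (simp add: s_def)
    have "h k \<le> 1 * h0 ^ k"
    proof -
      have "real (Suc k) powr (- (1 + 1 / \<sigma>)) \<le> real (Suc k) powr 0"
      proof (rule powr_mono)
        have "0 < 1 / \<sigma>" using \<sigma> by (rule divide_pos_pos[OF zero_less_one])
        then show "- (1 + 1 / \<sigma>) \<le> 0" by linarith
      qed simp
      then have "real (Suc k) powr (- (1 + 1 / \<sigma>)) / Z \<le> 1" using Z by (simp add: divide_le_eq)
      then show ?thesis unfolding h using h0(1) by (intro mult_right_mono) auto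
    qed
    moreover have "s \<le> h k" unfolding s_def using g1 D.s_pos[of k] by simp
    ultimately have s1: "s \<le> h0 ^ k" by simp
    have "real k * \<eta> = ln (1 / h0 ^ k)" using h0(1) by (simp add: \<eta>_def ln_div ln_realpow)
    also have "\<dots> \<le> ln (1 / s)" using s0 s1 h0(1) by (intro ln_mono divide_left_mono) auto
    finally have "real k * \<eta> \<le> ln (1 / s)" .
    \<comment> \<open>Passes from \<open>k\<close> to \<open>Suc k\<close>, the base used in the
      weights, at the price of a factor 2; this is where level 0 has to be excluded.\<close>
    moreover have "real (Suc k) * (\<eta> / 2) \<le> real k * \<eta>"
    proof -
      have "real (Suc k) \<le> 2 * real k" using k by simp
      then have "real (Suc k) * (\<eta> / 2) \<le> 2 * real k * (\<eta> / 2)" using \<eta> by (intro mult_right_mono) auto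
      then show ?thesis by simp
    qed
    ultimately have ln: "real (Suc k) * (\<eta> / 2) \<le> ln (1 / s)" by linarith
    have sp: "s powr \<sigma> * m ^ k = (D.gap / Z) powr \<sigma> * real (Suc k) powr (- (\<sigma> + 1))"
    proof -
      have "s = (D.gap / Z) * (real (Suc k) powr (- (1 + 1 / \<sigma>)) * h0 ^ k)" by (simp add: s_def h)
      then have "s powr \<sigma> = (D.gap / Z) powr \<sigma> * ((real (Suc k) powr (- (1 + 1 / \<sigma>))) powr \<sigma> * (h0 ^ k) powr \<sigma>)"
        using D.gap_pos Z h0(1) by (simp only: powr_mult) 
      also have "(real (Suc k) powr (- (1 + 1 / \<sigma>))) powr \<sigma> = real (Suc k) powr (- (\<sigma> + 1))"
      proof -
        have "- (1 + 1 / \<sigma>) * \<sigma> = - (\<sigma> + 1)" using \<sigma> by (simp only: mult_minus_left distrib_right) simp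
        then show ?thesis unfolding powr_powr by (simp only:)
      qed
      also have "(h0 ^ k) powr \<sigma> = (1 / m) ^ k" using h0 by (simp add: power_powr m_def)
      finally show ?thesis using m by (simp add: power_divide)
    qed
    have "C * real (Suc k) powr (\<mu> - \<sigma> - 1)
      = (D.gap / Z) powr \<sigma> * real (Suc k) powr (- (\<sigma> + 1)) * ((real (Suc k) * (\<eta> / 2)) powr \<mu>) / c"
    proof -
      have "real (Suc k) powr (\<mu> - \<sigma> - 1) = real (Suc k) powr (- (\<sigma> + 1)) * real (Suc k) powr \<mu>"
        unfolding powr_add[symmetric] by (simp add: algebra_simps)
      moreover have "(real (Suc k) * (\<eta> / 2)) powr \<mu> = real (Suc k) powr \<mu> * (\<eta> / 2) powr \<mu>"
        by (rule powr_mult)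
      ultimately show ?thesis by (simp only: C_def times_divide_eq_left times_divide_eq_right mult_ac)
    qed
    also have "\<dots> \<le> (D.gap / Z) powr \<sigma> * real (Suc k) powr (- (\<sigma> + 1)) * (ln (1 / s) powr \<mu>) / c"
      using ln \<eta> \<mu> \<sigma> c by (intro divide_right_mono mult_left_mono powr_mono2) auto
    also have "\<dots> = s powr \<sigma> * ln (1 / s) powr \<mu> / c * m ^ k" unfolding sp[symmetric] by simp
    also have "\<dots> \<le> \<Phi> s * m ^ k" using c(3)[OF s0] k(2) m by (intro mult_right_mono) (auto simp: s_def)
    finally show ?thesis by (simp add: s_def)
  qed
  have big: "ennreal K \<le> hausdorff_gauge \<Phi> (range (code_point h :: _ \<Rightarrow> real^'n))" if K: "K > 0" for K
  proof -
    have "(\<lambda>k. D.gap * h k) \<longlonglongrightarrow> 0" by (rule tendsto_mult_right_zero[OF D.s_tendsto_0])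
    then have "\<forall>\<^sub>F k in sequentially. D.gap * h k < r0" using c(2) by (rule order_tendstoD(2))
    then obtain k1 where k1: "\<And>k. k \<ge> k1 \<Longrightarrow> D.gap * h k < r0" unfolding eventually_sequentially by blast
    define k2 where "k2 = nat \<lceil>(K / C) powr (1 / (\<mu> - \<sigma> - 1))\<rceil>"
    have k2: "K \<le> C * real (Suc k) powr (\<mu> - \<sigma> - 1)" if "k \<ge> k2" for k
    proof -
      have "(K / C) powr (1 / (\<mu> - \<sigma> - 1)) \<le> real (Suc k)"
        using that real_nat_ceiling_ge[of "(K / C) powr (1 / (\<mu> - \<sigma> - 1))"] unfolding k2_def by linarith
      then have "((K / C) powr (1 / (\<mu> - \<sigma> - 1))) powr (\<mu> - \<sigma> - 1) \<le> real (Suc k) powr (\<mu> - \<sigma> - 1)"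
        using \<mu> by (intro powr_mono2) auto
      then have "K / C \<le> real (Suc k) powr (\<mu> - \<sigma> - 1)" using \<mu> K C by (simp add: powr_powr)
      then show ?thesis using C by (simp add: pos_divide_le_eq mult.commute)
    qed
    show ?thesis
    proof (rule hausdorff_gauge_ge_coded[OF \<Phi>, where s = "\<lambda>k. D.gap * h k" and ?k0.0 = "max 1 (max k1 k2)"])
      show "0 < D.gap * h k" for k using D.s_pos D.gap_pos by simp
      show "(\<lambda>k. D.gap * h k) \<longlonglongrightarrow> 0" by (rule tendsto_mult_right_zero[OF D.s_tendsto_0])
      show "\<forall>j\<le>k. e j = e' j" if "dist (code_point h e) (code_point h e') < D.gap * h k" for e e' :: "nat \<Rightarrow> bool^'n" and k
        by (rule D.code_point_separated[OF that])
      show "2 \<le> CARD(bool^'n)" using m mb by linarith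
      show "0 < K" by (rule K)
      fix k assume "max 1 (max k1 k2) \<le> k"
      then have k: "k \<ge> 1" "k \<ge> k1" "k \<ge> k2" by auto
      show "K \<le> \<Phi> (D.gap * h k) * real CARD(bool^'n) ^ k"
        unfolding mb by (rule order_trans[OF k2[OF k(3)] bound[OF k(1) k1[OF k(2)]]])
    qed
  qed
  show ?thesis
  proof (rule ccontr)
    assume "hausdorff_gauge \<Phi> (range (code_point h :: _ \<Rightarrow> real^'n)) \<noteq> \<infinity>"
    then obtain t where t: "t \<ge> 0" "hausdorff_gauge \<Phi> (range (code_point h :: _ \<Rightarrow> real^'n)) = ennreal t"
      by (metis ennreal_cases infinity_ennreal_def)
    have "ennreal (t + 1) \<le> ennreal t" using big[of "t + 1"] t by simp
    then show False using t(1) by simp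
  qed
qed

text \<open>Collects the powers of \<open>y = L * \<tau> ^ k\<close>: \<open>- n\<close> from the
  slope, \<open>q\<close> from the logarithm and 1 from the number of dyadic scales. By
  \<open>bal\<close> the remaining dependence on \<open>k\<close> cancels. The exponent
  \<open>Suc k\<close> counts cylinders that fix the digits 0 to \<open>k\<close>, and \<kappa>
  stands for the ratio of \<open>l + d\<close> to \<open>y\<close>.\<close>

lemma level_energy_le:
  fixes L \<tau> h0 q \<epsilon> \<kappa> m :: real and n k :: nat
  assumes L: "L \<ge> 1" and \<tau>: "\<tau> > 1" and h0: "h0 > 0" and q: "q \<ge> 0" and \<epsilon>: "\<epsilon> > 0" and \<kappa>: "\<kappa> \<ge> 1"
    and m: "m > 0" and bal: "m * h0 ^ n * \<tau> powr (q + 1 - real n) = 1"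
  shows "m ^ Suc k * ((2 * h0 ^ k * real n / (\<epsilon> * (L * \<tau> ^ k))) ^ n * (\<kappa> * (L * \<tau> ^ k)) powr q * (\<kappa> * (L * \<tau> ^ k) / ln 2 + 2))
    \<le> m * (2 * real n / \<epsilon>) ^ n * \<kappa> powr q * (4 * \<kappa>) * L powr (q + 1 - real n)"
proof -
  define y where "y = L * \<tau> ^ k"
  have \<tau>k: "1 \<le> \<tau> ^ k" using \<tau> by (intro one_le_power) simp
  have y1: "y \<ge> 1" unfolding y_def using mult_mono[OF L \<tau>k] L by simp
  have \<kappa>y: "\<kappa> * y \<ge> 1" using mult_mono[OF \<kappa> y1] \<kappa> by simp
  have f1: "\<kappa> * y / ln 2 + 2 \<le> 4 * \<kappa> * y"
  proof -
    have ln2: "ln 2 \<ge> (1/2::real)" using ln_le_minus_one[of "1/2::real"] by (simp add: ln_div)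
    have "\<kappa> * y / ln 2 \<le> \<kappa> * y / (1/2)" using ln2 \<kappa>y by (intro divide_left_mono) auto
    then show ?thesis using \<kappa>y by simp
  qed
  have f2: "(2 * h0 ^ k * real n / (\<epsilon> * y)) ^ n = (2 * real n / \<epsilon>) ^ n * (h0 ^ n) ^ k * y powr (- real n)"
  proof -
    have "2 * h0 ^ k * real n / (\<epsilon> * y) = 2 * real n / \<epsilon> * h0 ^ k * inverse y" by (simp add: divide_inverse mult_ac)
    then have "(2 * h0 ^ k * real n / (\<epsilon> * y)) ^ n = (2 * real n / \<epsilon>) ^ n * (h0 ^ k) ^ n * inverse y ^ n"
      by (simp only: power_mult_distrib)
    moreover have "inverse y ^ n = y powr (- real n)" using y1 by (simp add: powr_minus powr_realpow power_inverse)
    moreover have "(h0 ^ k) ^ n = (h0 ^ n) ^ k" by (simp only: power_mult[symmetric] mult.commute)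
    ultimately show ?thesis by (simp only:)
  qed
  have f3: "(\<kappa> * y) powr q = \<kappa> powr q * y powr q" by (rule powr_mult)
  have f4: "y powr (- real n) * y powr q * y = L powr (q + 1 - real n) * (\<tau> powr (q + 1 - real n)) ^ k"
  proof -
    have "y powr (- real n) * y powr q * y = y powr (- real n) * y powr q * y powr 1" using y1 by simp
    also have "\<dots> = y powr (q + 1 - real n)" unfolding powr_add[symmetric] by (simp add: algebra_simps)
    also have "\<dots> = L powr (q + 1 - real n) * (\<tau> ^ k) powr (q + 1 - real n)" unfolding y_def by (rule powr_mult)
    finally show ?thesis using \<tau> by (simp add: power_powr)
  qed
  have "m ^ Suc k * ((2 * h0 ^ k * real n / (\<epsilon> * y)) ^ n * (\<kappa> * y) powr q * (\<kappa> * y / ln 2 + 2))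
    \<le> m ^ Suc k * ((2 * h0 ^ k * real n / (\<epsilon> * y)) ^ n * (\<kappa> * y) powr q * (4 * \<kappa> * y))"
    using m h0 \<epsilon> y1 f1 by (intro mult_left_mono) auto
  also have "\<dots> = m * (2 * real n / \<epsilon>) ^ n * \<kappa> powr q * (4 * \<kappa>) * (m ^ k * (h0 ^ n) ^ k * (y powr (- real n) * y powr q * y))"
    unfolding f2 f3 power_Suc by (simp only: mult_ac)
  also have "m ^ k * (h0 ^ n) ^ k * (y powr (- real n) * y powr q * y)
      = L powr (q + 1 - real n) * (m * h0 ^ n * \<tau> powr (q + 1 - real n)) ^ k"
    unfolding f4 by (simp only: power_mult_distrib mult_ac)
  also have "\<dots> = L powr (q + 1 - real n)" unfolding bal by simp
  finally show ?thesis unfolding y_def by (simp only: mult_ac)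
qed

text \<open>The canonical code of a cylinder, continued with zero digits; its point is the centre of
  the cutoff. Digit \<open>k\<close> is kept because the displacement at level \<open>k\<close>
  depends on it.\<close>

definition truncate :: "nat \<Rightarrow> (nat \<Rightarrow> bool^'n::finite) \<Rightarrow> nat \<Rightarrow> bool^'n" where
  "truncate k e = (\<lambda>j. if j \<le> k then e j else (\<chi> i. False))"

lemma finite_range_truncate: "finite (range (truncate k :: (nat \<Rightarrow> bool^'n::finite) \<Rightarrow> _))"
  and card_range_truncate: "card (range (truncate k :: (nat \<Rightarrow> bool^'n::finite) \<Rightarrow> _)) \<le> (2 ^ CARD('n)) ^ Suc k"
proof -
  let ?S = "PiE {..k} (\<lambda>_. UNIV :: (bool^'n) set)"
  have sub: "range (truncate k :: (nat \<Rightarrow> bool^'n) \<Rightarrow> _) \<subseteq> truncate k ` ?S"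
  proof safe
    fix e :: "nat \<Rightarrow> bool^'n"
    have "truncate k e = truncate k (restrict e {..k})" by (auto simp: truncate_def fun_eq_iff)
    moreover have "restrict e {..k} \<in> ?S" by simp
    ultimately show "truncate k e \<in> truncate k ` ?S" by (rule image_eqI)
  qed
  have fS: "finite ?S" by (intro finite_PiE) auto
  show "finite (range (truncate k :: (nat \<Rightarrow> bool^'n) \<Rightarrow> _))" by (rule finite_subset[OF sub finite_imageI[OF fS]])
  have "card (range (truncate k :: (nat \<Rightarrow> bool^'n) \<Rightarrow> _)) \<le> card (truncate k ` ?S)"
    by (rule card_mono[OF finite_imageI[OF fS] sub])
  also have "\<dots> \<le> card ?S" by (rule card_image_le[OF fS])
  also have "card ?S = CARD(bool^'n) ^ Suc k" by (simp only: card_PiE finite_atMost prod_constant card_atMost)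
  finally show "card (range (truncate k :: (nat \<Rightarrow> bool^'n) \<Rightarrow> _)) \<le> (2 ^ CARD('n)) ^ Suc k"
    by (simp only: card_bool_vec)
qed

theorem theorem6p2:
  fixes A \<phi> \<Phi> :: "real \<Rightarrow> real" and q \<beta> \<sigma> \<mu> :: real
  assumes "young_function A"
    and "q > real CARD('n::finite) - 1"
    and "equiv_at_infinity A (\<lambda>t. t ^ CARD('n) * (ln t) powr q)"
    and "gauge_function \<phi>" and "\<beta> < 0"
    and "equiv_near_zero \<phi> (\<lambda>r. (ln (1 / r)) powr \<beta>)"
    and "\<sigma> = real CARD('n) * \<beta> / (real CARD('n) - q - 1 + \<beta>)"
    and "\<mu> > 1 + \<sigma>"
    and "gauge_function \<Phi>"
    and "equiv_near_zero \<Phi> (\<lambda>r. r powr \<sigma> * (ln (1 / r)) powr \<mu>)"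
  shows "\<exists>(u :: real^'n \<Rightarrow> real^'n) (E :: (real^'n) set).
           u \<in> V1A A \<and> continuous_on UNIV u \<and> compact E \<and>
           0 < hausdorff_gauge \<phi> E \<and> hausdorff_gauge \<phi> E < \<infinity> \<and>
           hausdorff_gauge \<Phi> (u ` E) = \<infinity>"
proof -
  note A = assms(1)
  define n where "n = CARD('n)"
  define m where "m = (2::real) ^ n"
  define \<tau> where "\<tau> = m powr (1 / - \<beta>)"
  define h0 where "h0 = m powr (- 1 / \<sigma>)"
  \<comment> \<open>On the logarithmic scale the distance from \<open>L * \<tau> ^ k\<close> to
    \<open>L * \<tau> ^ Suc k\<close> is cut into three equal pieces: a margin that keeps the outer
    balls apart, the transition zone of the cutoff, and a margin that keeps the next generation
    inside the plateau.\<close>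
  define \<epsilon> where "\<epsilon> = (\<tau> - 1) / 3"
  \<comment> \<open>The first entry serves the Hausdorff estimate of \<open>E\<close>; the second
    makes each margin at least \<open>2 * n\<close>, so that its exponential beats the constants 4
    and \<open>2 * n\<close>.\<close>
  define L where "L = max (4 * real n) (2 * real n / \<epsilon>)"
  define r where "r k = exp (- (L * \<tau> ^ k))" for k :: nat
  have n1: "1 \<le> real n" unfolding n_def by (rule one_le_CARD)
  have m2: "m \<ge> 2" using power_increasing[of 1 n "2::real"] n1 by (simp add: m_def)
  have q0: "q \<ge> 0" and qn: "q - real n + 1 > 0" using assms(2) n1 unfolding n_def by linarith+
  have \<sigma>eq: "\<sigma> = real n * (- \<beta>) / (q - real n + 1 + - \<beta>)"
  proof -
    have "real n - q - 1 + \<beta> = - (q - real n + 1 + - \<beta>)" by simp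
    then show ?thesis unfolding assms(7) n_def[symmetric] by (simp only: divide_minus_right mult_minus_right minus_divide_left)
  qed
  have \<sigma>0: "\<sigma> > 0" unfolding \<sigma>eq using n1 qn assms(5) by (intro divide_pos_pos mult_pos_pos) auto
  have n\<sigma>: "real n / \<sigma> = 1 + (q - real n + 1) / - \<beta>"
    unfolding \<sigma>eq using n1 qn assms(5) by (simp add: field_simps)
  have \<tau>1: "\<tau> > 1" unfolding \<tau>_def using m2 assms(5) by (intro gr_one_powr) auto
  have \<tau>\<beta>: "\<tau> powr \<beta> = 1 / m"
  proof -
    have "1 / - \<beta> * \<beta> = - 1" using assms(5) by simp
    then show ?thesis unfolding \<tau>_def powr_powr using m2 by (simp add: powr_minus divide_inverse)
  qed
  have h0pos: "h0 > 0" using m2 by (simp add: h0_def)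
  have h0\<sigma>: "h0 powr \<sigma> = 1 / m"
  proof -
    have "- 1 / \<sigma> * \<sigma> = - 1" using \<sigma>0 by simp
    then show ?thesis unfolding h0_def powr_powr using m2 by (simp add: powr_minus divide_inverse)
  qed
  \<comment> \<open>The condition \<open>q > n - 1\<close> is used here: it makes
    \<open>n / \<sigma>\<close> exceed 1, and \<open>h0 = 2 powr (- (n / \<sigma>))\<close>. Hence
    images of different cylinders stay separated.\<close>
  have h0half: "h0 < 1/2"
  proof -
    have "1 < real n / \<sigma>" unfolding n\<sigma> using qn assms(5) divide_pos_pos[of "q - real n + 1" "- \<beta>"] by linarith
    moreover have "h0 = 2 powr (- (real n / \<sigma>))"
      unfolding h0_def m_def by (simp add: powr_realpow[symmetric] powr_powr)
    moreover have "2 powr (- (real n / \<sigma>)) < 2 powr (- 1 :: real)" if "1 < real n / \<sigma>"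
      using that by (intro powr_less_mono) auto
    ultimately have "h0 < 2 powr (- 1)" by metis
    then show ?thesis by (simp add: powr_minus)
  qed
  \<comment> \<open>As a power of \<open>m\<close> the left side has exponent
    \<open>1 - n / \<sigma> + (q - n + 1) / - \<beta>\<close>, which is zero by
    \<open>n\<sigma>\<close>.\<close>
  have bal: "m * h0 ^ n * \<tau> powr (q + 1 - real n) = 1"
  proof -
    have "h0 ^ n = m powr (- (real n / \<sigma>))"
      unfolding h0_def using m2 by (subst powr_power) auto
    moreover have "\<tau> powr (q + 1 - real n) = m powr ((q - real n + 1) / - \<beta>)"
    proof -
      have "q + 1 - real n = q - real n + 1" by simp
      then show ?thesis unfolding \<tau>_def powr_powr by (simp only: times_divide_eq_left mult_1)
    qed
    moreover have "m = m powr 1" using m2 by simp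
    ultimately have "m * h0 ^ n * \<tau> powr (q + 1 - real n) = m powr (1 + - (real n / \<sigma>) + (q - real n + 1) / - \<beta>)"
      by (metis powr_add)
    also have "1 + - (real n / \<sigma>) + (q - real n + 1) / - \<beta> = 0" unfolding n\<sigma> by simp
    finally show ?thesis using m2 by simp
  qed
  have \<epsilon>0: "\<epsilon> > 0" using \<tau>1 by (simp add: \<epsilon>_def)
  have L4: "L \<ge> 4 * real n" and \<epsilon>L: "\<epsilon> * L \<ge> 2 * real n"
  proof -
    show "L \<ge> 4 * real n" by (simp add: L_def)
    have "2 * real n / \<epsilon> \<le> L" by (simp add: L_def)
    then show "\<epsilon> * L \<ge> 2 * real n" using \<epsilon>0 by (simp add: pos_divide_le_eq mult.commute)
  qed
  have \<tau>k: "1 \<le> \<tau> ^ k" for k using \<tau>1 by (intro one_le_power) simp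
  have Lk: "L \<le> L * \<tau> ^ k" for k using mult_left_mono[OF \<tau>k[of k], of L] L4 n1 by simp
  have \<epsilon>Lk: "2 * real n \<le> \<epsilon> * (L * \<tau> ^ k)" for k
    using mult_left_mono[OF Lk[of k] less_imp_le[OF \<epsilon>0]] \<epsilon>L by linarith
  have exp4: "exp (- (\<epsilon> * (L * \<tau> ^ k))) \<le> 1/4" for k
  proof -
    have "ln 4 \<le> \<epsilon> * (L * \<tau> ^ k)"
    proof -
      have "ln (4::real) = 2 * ln 2" using ln_realpow[of "2::real" 2] by simp
      also have "\<dots> \<le> 2" using ln_le_minus_one[of "2::real"] by simp
      finally show ?thesis using \<epsilon>Lk[of k] n1 by linarith
    qed
    then have "exp (- (\<epsilon> * (L * \<tau> ^ k))) \<le> exp (- ln 4)" by simp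
    then show ?thesis by (simp add: exp_minus)
  qed
  have expn: "2 * real n * exp (- (\<epsilon> * (L * \<tau> ^ k))) \<le> 1" for k
  proof -
    have "2 * real n \<le> exp (\<epsilon> * (L * \<tau> ^ k))" using \<epsilon>Lk[of k] exp_ge_add_one_self[of "\<epsilon> * (L * \<tau> ^ k)"] by linarith
    then show ?thesis by (simp add: exp_minus divide_inverse[symmetric])
  qed
  have \<tau>\<epsilon>: "\<tau> = 1 + 3 * \<epsilon>" by (simp add: \<epsilon>_def field_simps)
  have dw_r: "decaying_weights r (1/4)"
  proof
    show "0 < r k" for k by (simp add: r_def)
    show "r (Suc k) \<le> 1/4 * r k" for k
    proof -
      have "L * \<tau> ^ Suc k = L * \<tau> ^ k + 3 * (\<epsilon> * (L * \<tau> ^ k))" unfolding power_Suc by (subst \<tau>\<epsilon>) (simp add: algebra_simps)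
      then have "- (L * \<tau> ^ Suc k) \<le> - (\<epsilon> * (L * \<tau> ^ k)) + - (L * \<tau> ^ k)" using \<epsilon>Lk[of k] n1 by linarith
      then have "r (Suc k) \<le> exp (- (\<epsilon> * (L * \<tau> ^ k))) * r k"
        unfolding r_def exp_add[symmetric] by (simp only: exp_le_cancel_iff)
      also have "\<dots> \<le> 1/4 * r k" by (intro mult_right_mono exp4) (simp add: r_def)
      finally show ?thesis .
    qed
  qed auto
  interpret R: decaying_weights r "1/4" by (rule dw_r)
  \<comment> \<open>Shifted to \<open>Suc k\<close> because \<open>0 powr _ = 0\<close> would make
    the first weight vanish, whereas all \<open>h k\<close> must be positive. Division by
    \<open>Z\<close> gives total weight 1, as Jensen's inequality wants.\<close>
  define a0 where "a0 k = real (Suc k) powr (- (1 + 1 / \<sigma>))" for k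
  define Z where "Z = (\<Sum>k. a0 k)"
  define a where "a k = a0 k / Z" for k
  define h where "h k = a k * h0 ^ k" for k
  have \<sigma>inv: "0 < 1 / \<sigma>" using \<sigma>0 by simp
  have a0pos: "a0 k > 0" for k by (simp add: a0_def)
  have sa0: "summable a0"
  proof -
    have "summable (\<lambda>k. real k powr (- (1 + 1 / \<sigma>)))" using \<sigma>inv by (subst summable_real_powr_iff) linarith
    then show ?thesis unfolding a0_def[abs_def] by (subst summable_Suc_iff)
  qed
  have Z1: "Z \<ge> 1"
  proof -
    have "(\<Sum>k<1. a0 k) \<le> Z" unfolding Z_def using sa0 a0pos by (intro sum_le_suminf) (auto simp: less_imp_le)
    then show ?thesis by (simp add: a0_def)
  qed
  have apos: "a k > 0" for k using a0pos Z1 by (simp add: a_def)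
  have sa: "summable a" unfolding a_def[abs_def] using sa0 by (rule summable_divide)
  have suma: "(\<Sum>k. a k) \<le> 1"
    unfolding a_def suminf_divide[OF sa0] Z_def[symmetric] using Z1 by simp
  have adec: "a (Suc k) \<le> a k" for k
  proof -
    have "- (1 + 1 / \<sigma>) \<le> 0" using \<sigma>inv by linarith
    then have "a0 (Suc k) \<le> a0 k" unfolding a0_def by (intro powr_mono2') auto
    then show ?thesis unfolding a_def using Z1 by (intro divide_right_mono) auto
  qed
  have dw_h: "decaying_weights h h0"
  proof
    show "0 < h k" for k using apos h0pos by (simp add: h_def)
    show "h (Suc k) \<le> h0 * h k" for k
      using mult_right_mono[OF adec[of k], of "h0 ^ Suc k"] h0pos by (simp add: h_def mult_ac)
  qed (use h0pos h0half in auto)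
  define l where "l k = (1 + \<epsilon>) * (L * \<tau> ^ k)" for k :: nat
  define d where "d k = \<epsilon> * (L * \<tau> ^ k)" for k :: nat
  define P where "P k = range (truncate k :: (nat \<Rightarrow> bool^'n) \<Rightarrow> _)" for k
  define X where "X = (code_point r :: _ \<Rightarrow> real^'n)"
  have lr: "exp (- l k) \<le> 1/4 * r k" for k
  proof -
    have "exp (- l k) = exp (- (\<epsilon> * (L * \<tau> ^ k))) * r k"
      unfolding l_def r_def exp_add[symmetric] by (simp add: algebra_simps)
    also have "\<dots> \<le> 1/4 * r k" by (intro mult_right_mono exp4) (simp add: r_def)
    finally show ?thesis .
  qed
  have Lkpos: "L * \<tau> ^ k > 0" for k using Lk[of k] L4 n1 by linarith
  have bf: "bump_family (P k) X (\<lambda>p. digit (p k)) (h0 ^ k) (l k) (d k)" for k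
  proof
    show "finite (P k)" unfolding P_def by (rule finite_range_truncate)
    show "0 < d k" "0 < l k" using Lkpos[of k] \<epsilon>0 by (auto simp: d_def l_def)
    show "0 \<le> h0 ^ k" using h0pos by simp
    show "norm (digit (p k) :: real^'n) \<le> real CARD('n)" for p by (rule norm_digit_le)
    \<comment> \<open>Two truncated codes that differ do so at a level up to \<open>k\<close>, so
      the points are at least \<open>2/3 * r k\<close> apart, while the first margin gives
      \<open>2 * exp (- l k) \<le> 1/2 * r k\<close>.\<close>
    show "2 * exp (- l k) \<le> dist (X p) (X p')" if "p \<in> P k" "p' \<in> P k" "p \<noteq> p'" for p p'
    proof -
      have "\<exists>j\<le>k. p j \<noteq> p' j"
      proof (rule ccontr)
        assume "\<not> (\<exists>j\<le>k. p j \<noteq> p' j)"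
        then have "p j = p' j" for j using that(1,2) by (cases "j \<le> k") (auto simp: P_def truncate_def)
        then show False using that(3) by (auto simp: fun_eq_iff)
      qed
      then obtain j where "j \<le> k" "p j \<noteq> p' j" by blast
      then have "R.gap * r k \<le> dist (X p) (X p')" unfolding X_def by (rule R.dist_code_point_ge)
      moreover have "R.gap = 2/3" by (simp add: R.gap_def)
      ultimately show ?thesis using lr[of k] R.s_pos[of k] by simp
    qed
  qed
  define f where "f k = bump_family.field (P k) X (\<lambda>p. digit (p k)) (h0 ^ k) (l k) (d k)" for k
  define F where "F k = bump_family.grad (P k) X (\<lambda>p. digit (p k)) (h0 ^ k) (l k) (d k)" for k
  define u where "u x = (\<Sum>k. a k *\<^sub>R f k x)" for x
  \<comment> \<open>An exact identity: by the last margin \<open>X e\<close> lies in the plateau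
    around the centre of its cylinder, and the other cutoffs of the level vanish there. Summed over
    \<open>k\<close> with the weights, it makes \<open>u\<close> send the point of code
    \<open>e\<close> in \<open>E\<close> to the point with the same code and weights
    \<open>h\<close>.\<close>
  have fX: "f k (X e) = h0 ^ k *\<^sub>R digit (e k)" for k e
  proof -
    have "f k (X e) = h0 ^ k *\<^sub>R digit (truncate k e k)"
      unfolding f_def
    proof (rule bump_family.field_eq[OF bf, of "truncate k e"])
      show "truncate k e \<in> P k" by (simp add: P_def)
      have "dist (X e) (X (truncate k e)) \<le> 2 * real CARD('n) * r (Suc k)"
        unfolding X_def by (rule R.dist_code_point_le) (simp add: truncate_def)
      also have "\<dots> = (2 * real n * exp (- (\<epsilon> * (L * \<tau> ^ k)))) * exp (- (l k + d k))"
      proof -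
        have "L * \<tau> ^ Suc k = \<epsilon> * (L * \<tau> ^ k) + (l k + d k)"
          unfolding power_Suc l_def d_def by (subst \<tau>\<epsilon>) (simp add: algebra_simps)
        then show ?thesis unfolding r_def n_def by (simp add: exp_add[symmetric] mult.assoc)
      qed
      also have "\<dots> \<le> 1 * exp (- (l k + d k))" by (intro mult_right_mono expn) simp
      finally show "norm (X e - X (truncate k e)) \<le> exp (- (l k + d k))" by (simp add: dist_norm)
    qed
    then show ?thesis by (simp add: truncate_def)
  qed
  have uX: "u (X e) = code_point h e" for e
    unfolding u_def fX code_point_def h_def by simp
  have img: "u ` range X = range (code_point h :: _ \<Rightarrow> real^'n)"
    unfolding image_image uX ..
  obtain c t0 where c: "c > 0" "\<And>t. t > t0 \<Longrightarrow> A t \<le> c * (t ^ n * ln t powr q)"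
    using assms(3) unfolding equiv_at_infinity_def n_def by blast
  obtain t2 where t2: "t2 > 0" "A t2 > 0" using A unfolding young_function_def by blast
  define W where "W = m * (2 * real n / \<epsilon>) ^ n * (1 + 2 * \<epsilon>) powr q * (4 * (1 + 2 * \<epsilon>)) * L powr (q + 1 - real n)"
  \<comment> \<open>The bound must not depend on \<open>k\<close>, and
    \<open>level_energy_le\<close> provides this. The threshold \<open>max 1 t0\<close> keeps the
    logarithms nonnegative, and the radius \<open>2 * n\<close> contains all centres because
    \<open>r 0 \<le> 1\<close>.\<close>
  have majorant: "\<exists>M. M \<in> borel_measurable borel \<and> (\<forall>x. norm (F k x) \<le> M x \<and> A (norm (F k x)) \<le> M x) \<and>
    (\<integral>\<^sup>+x. ennreal (M x) \<partial>lborel) \<le>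
      ennreal ((A (max 1 t0) + c + t2 + t2 / A t2 * (A (max 1 t0) + c)) * (unit_ball_vol n * (2 * real n + 1) ^ n + 2 ^ n * unit_ball_vol n * W))" for k
    unfolding F_def n_def
  proof (rule bump_family.grad_majorant[OF bf A])
    show "1 \<le> max 1 t0" "0 \<le> c" "0 \<le> q" "t2 > 0" "A t2 > 0" using c q0 t2 by auto
    show "A t \<le> c * (t ^ CARD('n) * ln t powr q)" if "t > max 1 t0" for t using c(2)[of t] that by (simp add: n_def)
    have h0k: "h0 ^ k \<le> 1" using h0pos h0half by (intro power_le_one) auto
    show "2 * h0 ^ k * real CARD('n) / d k \<le> 1"
    proof -
      have "2 * h0 ^ k * real n \<le> 2 * 1 * real n" using h0k by (intro mult_right_mono mult_left_mono) auto
      then have "2 * h0 ^ k * real n \<le> d k" using \<epsilon>Lk[of k] by (simp add: d_def)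
      then show ?thesis using Lkpos[of k] \<epsilon>0 by (simp add: d_def n_def)
    qed
    show "0 \<le> 2 * real CARD('n)" by simp
    show "norm (X p) \<le> 2 * real CARD('n)" for p
    proof -
      have "norm (X p) \<le> 2 * real CARD('n) * r 0" unfolding X_def by (rule R.norm_code_point_le)
      also have "\<dots> \<le> 2 * real CARD('n) * 1" using L4 n1 by (intro mult_left_mono) (auto simp: r_def)
      finally show ?thesis by simp
    qed
    have ld: "l k + d k = (1 + 2 * \<epsilon>) * (L * \<tau> ^ k)" by (simp add: l_def d_def algebra_simps)
    let ?T = "(2 * h0 ^ k * real n / (\<epsilon> * (L * \<tau> ^ k))) ^ n * ((1 + 2 * \<epsilon>) * (L * \<tau> ^ k)) powr q * ((1 + 2 * \<epsilon>) * (L * \<tau> ^ k) / ln 2 + 2)"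
    have "real (card (P k)) \<le> m ^ Suc k"
    proof -
      have "real (card (P k)) \<le> real ((2 ^ CARD('n)) ^ Suc k)" unfolding P_def of_nat_le_iff by (rule card_range_truncate)
      then show ?thesis by (simp add: m_def n_def)
    qed
    moreover have "0 \<le> ?T" using h0pos \<epsilon>0 L4 n1 \<tau>1 by (intro mult_nonneg_nonneg add_nonneg_nonneg divide_nonneg_nonneg zero_le_power) auto
    ultimately have "real (card (P k)) * ?T \<le> m ^ Suc k * ?T" by (rule mult_right_mono)
    also have "\<dots> \<le> W" unfolding W_def
      using level_energy_le[of L \<tau> h0 q \<epsilon> "1 + 2 * \<epsilon>" m n k] L4 n1 \<tau>1 h0pos q0 \<epsilon>0 m2 bal by simp
    finally show "real (card (P k)) * ((2 * h0 ^ k * real CARD('n) / d k) ^ CARD('n) * (l k + d k) powr q * ((l k + d k) / ln 2 + 2)) \<le> W"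
      unfolding ld unfolding d_def n_def .
  qed
  then obtain M where M: "\<And>k. M k \<in> borel_measurable borel" "\<And>k x. norm (F k x) \<le> M k x" "\<And>k x. A (norm (F k x)) \<le> M k x"
    "\<And>k. (\<integral>\<^sup>+x. ennreal (M k x) \<partial>lborel) \<le>
      ennreal ((A (max 1 t0) + c + t2 + t2 / A t2 * (A (max 1 t0) + c)) * (unit_ball_vol n * (2 * real n + 1) ^ n + 2 ^ n * unit_ball_vol n * W))"
    by metis
  have bnd: "norm (f k x) \<le> real CARD('n)" for k x
  proof -
    have "norm (f k x) \<le> h0 ^ k * real CARD('n)" unfolding f_def by (rule bump_family.norm_field_le[OF bf])
    also have "\<dots> \<le> 1 * real CARD('n)" using h0pos h0half by (intro mult_right_mono power_le_one) auto
    finally show ?thesis by simp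
  qed
  have cf: "continuous_on UNIV (f k)" for k unfolding f_def by (rule bump_family.continuous_on_field[OF bf])
  have mF: "F k \<in> borel_measurable borel" for k unfolding F_def by (rule bump_family.borel_measurable_grad[OF bf])
  have pf: "(\<integral>x. f k x $ i * partial_deriv j \<psi> x \<partial>lborel) = - (\<integral>x. F k x $ i $ j * \<psi> x \<partial>lborel)"
    if "test_function \<psi>" for k \<psi> i j
    unfolding f_def F_def by (rule bump_family.field_by_parts[OF bf that])
  note V = V1A_suminf[OF A less_imp_le[OF apos] sa suma cf bnd mF pf M]
  have "u \<in> V1A A" "continuous_on UNIV u" using V unfolding u_def[abs_def] by auto
  moreover have "compact (range X)" unfolding X_def by (rule R.compact_range_code_point)
  moreover have "0 < hausdorff_gauge \<phi> (range X)" "hausdorff_gauge \<phi> (range X) < \<infinity>"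
    unfolding X_def
    using hausdorff_gauge_log_cantor[OF assms(4,5,6), of L \<tau> r, where 'n='n] L4 \<tau>1 \<tau>\<beta> dw_r
    by (simp_all add: n_def m_def r_def)
  moreover have "hausdorff_gauge \<Phi> (u ` range X) = \<infinity>"
    unfolding img
  proof (rule hausdorff_gauge_power_log_cantor[OF assms(9) \<sigma>0 assms(8) assms(10) Z1 h0pos])
    show "h0 powr \<sigma> = 1 / 2 ^ CARD('n)" using h0\<sigma> by (simp add: m_def n_def)
    show "h k = real (Suc k) powr (- (1 + 1 / \<sigma>)) / Z * h0 ^ k" for k by (simp only: h_def a_def a0_def)
    show "decaying_weights h h0" by (rule dw_h)
  qed
  ultimately show ?thesis by blast
qed

end
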